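(* Let $X,U$ be Banach spaces and consider a boundary control system $\dot x(t)=\hat A x(t)$, $x(0)=x_0$, $\hat G x(t)=u(t)$, with associated semigroup generator $A$ and lifting operator $G$. Assume that the corresponding input operator $B:=\hat AG-A_{-1}G\in L(U,X_{-1})$ is $q$-admissible for some $q\in[1,+\infty)$, and that $A$ generates an exponentially stable semigroup. Then for any $p\in[q,+\infty]$ the triple $\Sigma:=(X,\mathcal U,\phi)$ with $\mathcal U:=L_p(\mathbb R_+,U)$, where $\phi$ is the mild solution map of the boundary control system, is an ISS control system (with respect to the norm in $\mathcal U$).
   Context: $\mathbb R_+=[0,\infty)$. Boundary control system: $\hat A:D(\hat A)\subset X\to X$ and $\hat G:D(\hat G)\subset X\to U$ are linear operators with $D(\hat A)\subset D(\hat G)$, such that (i) the operator $A:D(A)\to X$ with $D(A)=D(\hat A)\cap\ker(\hat G)$, $Ax=\hat Ax$, is the infinitesimal generator of a $C_0$-semigroup $T$ on $X$; (ii) there is $G\in L(U,X)$ (a lifting operator) such that for all $u\in U$ we have $Gu\in D(\hat A)$, $\hat AG\in L(U,X)$ and $\hat GGu=u$. The extrapolation space $X_{-1}$ is the completion of $X$ with respect to $\|x\|_{X_{-1}}:=\|(aI-A)^{-1}x\|_X$ for some $a$ in the resolvent set of $A$; $T_{-1}$ is the unique extension of $T$ to a strongly continuous semigroup on $X_{-1}$, with generator $A_{-1}$ extending $A$, $D(A_{-1})=X$. $B\in L(U,X_{-1})$ is $q$-admissible if there is $t>0$ with $\int_0^tT_{-1}(t-s)Bu(s)\,ds\in X$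 for all $u\in L_q(\mathbb R_+,U)$. The mild solution of the boundary control system is $\phi(t,x_0,u)=T(t)x_0+\int_0^tT_{-1}(t-r)Bu(r)\,dr$. A control system is a triple $\Sigma=(X,\mathcal U,\phi)$ where: $X$ is a normed vector space; $\mathcal U\subset\{u:\mathbb R_+\to U\}$ is a normed vector space ($U$ normed) such that for $u\in\mathcal U$, $\tau\ge0$ one has $u(\cdot+\tau)\in\mathcal U$ and $\|u\|_{\mathcal U}\ge\|u(\cdot+\tau)\|_{\mathcal U}$, and for $u_1,u_2\in\mathcal U$, $t>0$ the concatenation equal to $u_1(\tau)$ for $\tau\in[0,t]$ and $u_2(\tau-t)$ otherwise belongs to $\mathcal U$; $\phi:D_\phi\to X$, $D_\phi\subseteq\mathbb R_+\times X\times\mathcal U$, where for all $(x,u)$ there is $t_m=t_m(x,u)\in(0,+\infty]$ with $D_\phi\cap(\mathbb R_+\times\{(x,u)\})=[0,t_m)\times\{(x,u)\}$; and the following hold: $\phi(0,x,u)=x$; causality (if $(t,x,u)\in D_\phi$ and $\tilde u\in\mathcal U$ coincides with $u$ on $[0,t]$, then $[0,t]\times\{(x,\tilde u)\}\subset D_\phi$ and $\phi(t,x,u)=\phi(t,x,\tilde u)$); $t\mapsto\phi(t,x,u)$ is continuous on its maximal domain; cocycle property ($\phi(h,\phi(t,x,u),u(t+\cdot))=\phi(t+h,x,u)$ whenever $t,h\ge0$ and $[0,t+h]\times\{(x,u)\}\subset D_\phi$). It is forward complete if $D_\phi=\mathbb R_+\times X\times\mathcal U$. A forward complete control system is ISS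 if there exist $\beta\in\mathcal{KL}$, $\gamma\in\mathcal K_\infty$ with $\|\phi(t,x,u)\|_X\le\beta(\|x\|_X,t)+\gamma(\|u\|_{\mathcal U})$ for all $x\in X$, $u\in\mathcal U$, $t\ge0$. Here $\mathcal K_\infty$ is the set of continuous, strictly increasing, unbounded $\gamma:\mathbb R_+\to\mathbb R_+$ with $\gamma(0)=0$; $\mathcal{KL}$ is the set of continuous $\beta:\mathbb R_+^2\to\mathbb R_+$ such that $\beta(\cdot,t)$ is strictly increasing with $\beta(0,t)=0$ for all $t\ge0$, and $\beta(r,\cdot)$ is strictly decreasing to $0$ for all $r>0$. *)

theory Defs
  imports "HOL-Analysis.Analysis" "HOL-Probability.Essential_Supremum"
begin

section \<open>Vector-valued integration and Lebesgue spaces\<close>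

text \<open>
  The Bochner integral of the library is only available for second countable (that is, separable)
  range spaces. The following are the same notions for arbitrary normed spaces.
\<close>

definition strongly_measurable :: "'a measure \<Rightarrow> ('a \<Rightarrow> 'b::real_normed_vector) \<Rightarrow> bool" where
  "strongly_measurable M f \<longleftrightarrow>
     (\<exists>s. (\<forall>i::nat. simple_function M (s i)) \<and> (AE x in M. (\<lambda>i. s i x) \<longlonglongrightarrow> f x))"

definition has_vec_integral :: "'a measure \<Rightarrow> ('a \<Rightarrow> 'b) \<Rightarrow> 'b::real_normed_vector \<Rightarrow> bool" where
  "has_vec_integral M f I \<longleftrightarrow> f \<in> borel_measurable M \<and>
     (\<exists>s. (\<forall>i::nat. Bochner_Integration.simple_bochner_integrable M (s i)) \<and>
          (\<lambda>i. \<integral>\<^sup>+x. ennreal (norm (f x - s i x)) \<partial>M) \<longlonglongrightarrow> 0 \<and>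
          (\<lambda>i. Bochner_Integration.simple_bochner_integral M (s i)) \<longlonglongrightarrow> I)"

text \<open>
  \<open>L\<^sub>p(\<real>\<^sub>+, U)\<close> for \<open>p \<in> [1, \<infinity>]\<close>, as a space of representatives: functions that agree almost
  everywhere on \<open>[0, \<infinity>)\<close> have distance \<open>0\<close>, and values at negative arguments are irrelevant.
\<close>

definition Lp_space :: "ennreal \<Rightarrow> (real \<Rightarrow> 'u::real_normed_vector) set" where
  "Lp_space p = {u. strongly_measurable (lebesgue_on {0..}) u \<and>
     (if p = \<infinity> then esssup (lebesgue_on {0..}) (\<lambda>t. ennreal (norm (u t))) < \<infinity>
      else integrable (lebesgue_on {0..}) (\<lambda>t. norm (u t) powr enn2real p))}"

definition Lp_norm :: "ennreal \<Rightarrow> (real \<Rightarrow> 'u::real_normed_vector) \<Rightarrow> real" where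
  "Lp_norm p u =
     (if p = \<infinity> then enn2real (esssup (lebesgue_on {0..}) (\<lambda>t. ennreal (norm (u t))))
      else (LINT t|lebesgue_on {0..}. norm (u t) powr enn2real p) powr (1 / enn2real p))"

section \<open>Control systems and input-to-state stability\<close>

definition concat_input :: "real \<Rightarrow> (real \<Rightarrow> 'u) \<Rightarrow> (real \<Rightarrow> 'u) \<Rightarrow> real \<Rightarrow> 'u" where
  "concat_input t u1 u2 = (\<lambda>s. if s \<le> t then u1 s else u2 (s - t))"

text \<open>
  An input space is a vector space \<open>\<U>\<close> of functions on \<open>[0, \<infinity>)\<close> with norm \<open>N\<close>. As in \<open>L\<^sub>p\<close>-spaces,
  functions \<open>u\<close>, \<open>v\<close> with \<open>N (u - v) = 0\<close> are regarded as the same input, so \<open>N\<close> is definite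
  on inputs although it is only a seminorm on functions.
  Functions on \<open>[0, \<infinity>)\<close> are represented by functions on \<open>real\<close>, whose values at negative
  arguments are ignored (\<open>nonneg_only\<close>).
\<close>

locale input_space =
  fixes \<U> :: "(real \<Rightarrow> 'u::real_normed_vector) set"
    and N :: "(real \<Rightarrow> 'u) \<Rightarrow> real"
  assumes zero_in: "(\<lambda>_. 0) \<in> \<U>"
    and add_in: "\<And>u v. u \<in> \<U> \<Longrightarrow> v \<in> \<U> \<Longrightarrow> (\<lambda>t. u t + v t) \<in> \<U>"
    and scale_in: "\<And>c u. u \<in> \<U> \<Longrightarrow> (\<lambda>t. c *\<^sub>R u t) \<in> \<U>"
    and norm_nonneg: "\<And>u. u \<in> \<U> \<Longrightarrow> 0 \<le> N u"
    and norm_scale: "\<And>c u. u \<in> \<U> \<Longrightarrow> N (\<lambda>t. c *\<^sub>R u t) = \<bar>c\<bar> * N u"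
    and norm_triangle: "\<And>u v. u \<in> \<U> \<Longrightarrow> v \<in> \<U> \<Longrightarrow> N (\<lambda>t. u t + v t) \<le> N u + N v"
    and nonneg_only: "\<And>u v. u \<in> \<U> \<Longrightarrow> (\<forall>t\<ge>0. v t = u t) \<Longrightarrow> v \<in> \<U> \<and> N (\<lambda>t. u t - v t) = 0"
    and shift_in: "\<And>u \<tau>. u \<in> \<U> \<Longrightarrow> 0 \<le> \<tau> \<Longrightarrow> (\<lambda>t. u (t + \<tau>)) \<in> \<U>"
    and norm_shift: "\<And>u \<tau>. u \<in> \<U> \<Longrightarrow> 0 \<le> \<tau> \<Longrightarrow> N (\<lambda>t. u (t + \<tau>)) \<le> N u"
    and concat_in: "\<And>u1 u2 t. u1 \<in> \<U> \<Longrightarrow> u2 \<in> \<U> \<Longrightarrow> 0 < t \<Longrightarrow> concat_input t u1 u2 \<in> \<U>"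

text \<open>
  \<open>D\<close> is the domain of the partial map \<open>\<phi>\<close>; the state space is the whole type \<open>'x\<close>. The assumption
  \<open>identify\<close> says that \<open>\<phi>\<close> is well defined on inputs, that is, on functions up to distance \<open>0\<close>.
\<close>

locale control_system = input_space \<U> N
  for \<U> :: "(real \<Rightarrow> 'u::real_normed_vector) set" and N :: "(real \<Rightarrow> 'u) \<Rightarrow> real" +
  fixes D :: "(real \<times> 'x::real_normed_vector \<times> (real \<Rightarrow> 'u)) set"
    and \<phi> :: "real \<Rightarrow> 'x \<Rightarrow> (real \<Rightarrow> 'u) \<Rightarrow> 'x"
  assumes dom_subset: "D \<subseteq> {0..} \<times> UNIV \<times> \<U>"
    and dom_interval: "\<And>x u. u \<in> \<U> \<Longrightarrow>
          \<exists>tm::ereal. 0 < tm \<and> (\<forall>t. (t, x, u) \<in> D \<longleftrightarrow> 0 \<le> t \<and> ereal t < tm)"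
    and identify: "\<And>t x u v. (t, x, u) \<in> D \<Longrightarrow> v \<in> \<U> \<Longrightarrow> N (\<lambda>s. u s - v s) = 0 \<Longrightarrow>
          (t, x, v) \<in> D \<and> \<phi> t x u = \<phi> t x v"
    and initial: "\<And>x u. u \<in> \<U> \<Longrightarrow> \<phi> 0 x u = x"
    and causal: "\<And>t x u v. (t, x, u) \<in> D \<Longrightarrow> v \<in> \<U> \<Longrightarrow> (\<forall>s\<in>{0..t}. v s = u s) \<Longrightarrow>
          {0..t} \<times> {(x, v)} \<subseteq> D \<and> \<phi> t x u = \<phi> t x v"
    and continuous: "\<And>x u. u \<in> \<U> \<Longrightarrow> continuous_on {t. (t, x, u) \<in> D} (\<lambda>t. \<phi> t x u)"
    and cocycle: "\<And>t h x u. u \<in> \<U> \<Longrightarrow> 0 \<le> t \<Longrightarrow> 0 \<le> h \<Longrightarrow> {0..t + h} \<times> {(x, u)} \<subseteq> D \<Longrightarrow>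
          (h, \<phi> t x u, \<lambda>s. u (t + s)) \<in> D \<and>
          \<phi> h (\<phi> t x u) (\<lambda>s. u (t + s)) = \<phi> (t + h) x u"

definition forward_complete ::
  "(real \<Rightarrow> 'u) set \<Rightarrow> (real \<times> 'x \<times> (real \<Rightarrow> 'u)) set \<Rightarrow> bool" where
  "forward_complete \<U> D \<longleftrightarrow> D = {0..} \<times> UNIV \<times> \<U>"

definition class_K_inf :: "(real \<Rightarrow> real) set" where
  "class_K_inf = {\<gamma>. continuous_on {0..} \<gamma> \<and> strict_mono_on {0..} \<gamma> \<and> \<gamma> 0 = 0 \<and>
     \<not> bounded (\<gamma> ` {0..})}"

definition class_KL :: "(real \<Rightarrow> real \<Rightarrow> real) set" where
  "class_KL = {\<beta>. continuous_on ({0..} \<times> {0..}) (\<lambda>(r, t). \<beta> r t) \<and>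
     (\<forall>t\<ge>0. strict_mono_on {0..} (\<lambda>r. \<beta> r t) \<and> \<beta> 0 t = 0) \<and>
     (\<forall>r>0. strict_antimono_on {0..} (\<beta> r) \<and> (\<beta> r \<longlongrightarrow> 0) at_top)}"

definition ISS_control_system ::
  "(real \<Rightarrow> 'u::real_normed_vector) set \<Rightarrow> ((real \<Rightarrow> 'u) \<Rightarrow> real) \<Rightarrow>
   (real \<times> 'x::real_normed_vector \<times> (real \<Rightarrow> 'u)) set \<Rightarrow>
   (real \<Rightarrow> 'x \<Rightarrow> (real \<Rightarrow> 'u) \<Rightarrow> 'x) \<Rightarrow> bool" where
  "ISS_control_system \<U> N D \<phi> \<longleftrightarrow> control_system \<U> N D \<phi> \<and> forward_complete \<U> D \<and>
     (\<exists>\<beta>\<in>class_KL. \<exists>\<gamma>\<in>class_K_inf. \<forall>x. \<forall>u\<in>\<U>. \<forall>t\<ge>0.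
        norm (\<phi> t x u) \<le> \<beta> (norm x) t + \<gamma> (N u))"

section \<open>Semigroups and boundary control systems\<close>

definition C0_semigroup :: "(real \<Rightarrow> 'x::real_normed_vector \<Rightarrow>\<^sub>L 'x) \<Rightarrow> bool" where
  "C0_semigroup T \<longleftrightarrow> T 0 = id_blinfun \<and>
     (\<forall>s\<ge>0. \<forall>t\<ge>0. T (s + t) = T s o\<^sub>L T t) \<and>
     (\<forall>x. ((\<lambda>t. T t x) \<longlongrightarrow> x) (at_right 0))"

text \<open>
  An unbounded operator is a pair of a domain and a function, whose values outside the domain are
  ignored.
\<close>

definition linear_operator ::
  "'x::real_vector set \<Rightarrow> ('x \<Rightarrow> 'y::real_vector) \<Rightarrow> bool" where
  "linear_operator D A \<longleftrightarrow> subspace D \<and>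
     (\<forall>x\<in>D. \<forall>y\<in>D. A (x + y) = A x + A y) \<and> (\<forall>c. \<forall>x\<in>D. A (c *\<^sub>R x) = c *\<^sub>R A x)"

definition generates ::
  "'x::real_normed_vector set \<Rightarrow> ('x \<Rightarrow> 'x) \<Rightarrow> (real \<Rightarrow> 'x \<Rightarrow>\<^sub>L 'x) \<Rightarrow> bool" where
  "generates D A T \<longleftrightarrow> C0_semigroup T \<and>
     (\<forall>x y. x \<in> D \<and> A x = y \<longleftrightarrow> ((\<lambda>h. (T h x - x) /\<^sub>R h) \<longlongrightarrow> y) (at_right 0))"

definition exponentially_stable :: "(real \<Rightarrow> 'x::real_normed_vector \<Rightarrow>\<^sub>L 'x) \<Rightarrow> bool" where
  "exponentially_stable T \<longleftrightarrow> (\<exists>M. \<exists>\<omega>>0. \<forall>t\<ge>0. norm (T t) \<le> M * exp (- \<omega> * t))"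

definition resolvent :: "'x::real_normed_vector set \<Rightarrow> ('x \<Rightarrow> 'x) \<Rightarrow> real \<Rightarrow> 'x \<Rightarrow> 'x" where
  "resolvent D A a = inv_into D (\<lambda>x. a *\<^sub>R x - A x)"

definition resolvent_set :: "'x::real_normed_vector set \<Rightarrow> ('x \<Rightarrow> 'x) \<Rightarrow> real set" where
  "resolvent_set D A =
     {a. bij_betw (\<lambda>x. a *\<^sub>R x - A x) D UNIV \<and> bounded_linear (resolvent D A a)}"

locale boundary_control_system =
  fixes DA :: "'x::banach set" and hatA :: "'x \<Rightarrow> 'x"
    and DG :: "'x set" and hatG :: "'x \<Rightarrow> 'u::banach"
    and T :: "real \<Rightarrow> 'x \<Rightarrow>\<^sub>L 'x"
    and G :: "'u \<Rightarrow>\<^sub>L 'x"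
  assumes linear_hatA: "linear_operator DA hatA"
    and linear_hatG: "linear_operator DG hatG"
    and dom_le: "DA \<subseteq> DG"
    and generator: "generates (DA \<inter> {x \<in> DG. hatG x = 0}) hatA T"
    and lifting_dom: "\<And>u. G u \<in> DA"
    and lifting_bounded: "bounded_linear (\<lambda>u. hatA (G u))"
    and lifting: "\<And>u. hatG (G u) = u"

text \<open>
  The extrapolation space of the generator \<open>(D, A)\<close> of \<open>T\<close> is a Banach space \<open>'e\<close> with a map \<open>j\<close>
  exhibiting it as a completion of \<open>'x\<close> with respect to the norm \<open>x \<mapsto> \<parallel>(aI - A)\<^sup>-\<^sup>1 x\<parallel>\<close>; the
  inclusion of \<open>'x\<close> is \<open>j\<close>. \<open>T1\<close> and \<open>A1\<close> are \<open>T\<^sub>-\<^sub>1\<close> and \<open>A\<^sub>-\<^sub>1\<close>, the latter with domain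
  \<open>range j\<close>.
\<close>

locale extrapolation_space =
  fixes D :: "'x::banach set" and A :: "'x \<Rightarrow> 'x" and T :: "real \<Rightarrow> 'x \<Rightarrow>\<^sub>L 'x"
    and a :: real and j :: "'x \<Rightarrow> 'e::banach"
    and T1 :: "real \<Rightarrow> 'e \<Rightarrow>\<^sub>L 'e" and A1 :: "'e \<Rightarrow> 'e"
  assumes a_resolvent: "a \<in> resolvent_set D A"
    and j_linear: "linear j"
    and j_norm: "\<And>x. norm (j x) = norm (resolvent D A a x)"
    and j_dense: "closure (range j) = UNIV"
    and T1_extends: "\<And>t x. 0 \<le> t \<Longrightarrow> T1 t (j x) = j (T t x)"
    and T1_generator: "generates (range j) A1 T1"

text \<open>\<open>\<integral>\<^sub>0\<^sup>t T\<^sub>-\<^sub>1(t - r) B u(r) dr\<close> exists, lies in \<open>X\<close> and, as an element of \<open>X\<close>, equals \<open>y\<close>.\<close>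

definition input_integral ::
  "('x \<Rightarrow> 'e::real_normed_vector) \<Rightarrow> (real \<Rightarrow> 'e \<Rightarrow>\<^sub>L 'e) \<Rightarrow> ('u::real_normed_vector \<Rightarrow>\<^sub>L 'e) \<Rightarrow>
   real \<Rightarrow> (real \<Rightarrow> 'u) \<Rightarrow> 'x \<Rightarrow> bool" where
  "input_integral j T1 B t u y \<longleftrightarrow>
     has_vec_integral (lebesgue_on {0..t}) (\<lambda>r. T1 (t - r) (B (u r))) (j y)"

definition admissible ::
  "('x \<Rightarrow> 'e::real_normed_vector) \<Rightarrow> (real \<Rightarrow> 'e \<Rightarrow>\<^sub>L 'e) \<Rightarrow> ('u::real_normed_vector \<Rightarrow>\<^sub>L 'e) \<Rightarrow>
   ennreal \<Rightarrow> bool" where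
  "admissible j T1 B q \<longleftrightarrow> (\<exists>t>0. \<forall>u\<in>Lp_space q. \<exists>y. input_integral j T1 B t u y)"

text \<open>
  The mild solution on its natural domain, consisting of those \<open>(t, x, u)\<close> for which the defining
  formula is meaningful in \<open>X\<close>.
\<close>

definition mild_domain ::
  "('x \<Rightarrow> 'e::real_normed_vector) \<Rightarrow> (real \<Rightarrow> 'e \<Rightarrow>\<^sub>L 'e) \<Rightarrow> ('u::real_normed_vector \<Rightarrow>\<^sub>L 'e) \<Rightarrow>
   (real \<Rightarrow> 'u) set \<Rightarrow> (real \<times> 'x \<times> (real \<Rightarrow> 'u)) set" where
  "mild_domain j T1 B \<U> = {(t, x, u). 0 \<le> t \<and> u \<in> \<U> \<and> (\<exists>y. input_integral j T1 B t u y)}"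

definition mild_solution ::
  "(real \<Rightarrow> 'x \<Rightarrow>\<^sub>L 'x) \<Rightarrow> ('x::real_normed_vector \<Rightarrow> 'e::real_normed_vector) \<Rightarrow>
   (real \<Rightarrow> 'e \<Rightarrow>\<^sub>L 'e) \<Rightarrow> ('u::real_normed_vector \<Rightarrow>\<^sub>L 'e) \<Rightarrow>
   real \<Rightarrow> 'x \<Rightarrow> (real \<Rightarrow> 'u) \<Rightarrow> 'x" where
  "mild_solution T j T1 B t x u = T t x + (THE y. input_integral j T1 B t u y)"

end

theory Submission
  imports Defs
begin

text \<open>
  Let \<open>\<Phi> t u\<close> be the input integral. If \<open>\<Phi> t0\<close> maps \<open>L\<^sub>q\<close> into \<open>X\<close>, then so does every \<open>\<Phi> t\<close>: delay the
  input for \<open>t \<le> t0\<close>, and use \<open>\<Phi> (t + h) u = T h (\<Phi> t u) + \<Phi> h (u (t + \<cdot>))\<close> for larger \<open>t\<close>. Since \<open>\<Phi> t\<close>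
  is bounded into the extrapolation space, it is a pointwise limit of bounded operators into \<open>X\<close>,
  hence bounded by the uniform boundedness principle. For \<open>\<tau>\<close> with \<open>\<parallel>T \<tau>\<parallel> \<le> 1/2\<close> the composition
  formula makes the bounds \<open>K\<close> on \<open>[0, \<tau>]\<close> sum up to \<open>2 K\<close> for all times, and on bounded intervals the
  \<open>L\<^sub>q\<close>-norm is controlled by the \<open>L\<^sub>p\<close>-norm. This gives ISS with linear gain.
\<close>

section \<open>Vector-valued integrals\<close>

text \<open>No separability is assumed, so Borel functions need not be closed under sums, and
  measurability rests on approximation by simple functions almost everywhere. Inputs are
  representatives, so the L_p norm is only a seminorm on functions; completeness is therefore stated
  as convergence of absolutely summable series, exactly the form that the uniform boundedness
  argument consumes. The main obstacle is that admissibility is qualitative: an integral formed in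
  the larger space happens to lie in X, with no estimate there. The bridge is a sequence of maps
  \<open>V n\<close> on X that converge pointwise to the identity and are each bounded by the weaker
  extrapolation norm. Estimates in X are first made in L_q and then passed to L_p by truncating the
  input, since on a bounded interval L_p is contained in L_q. The hypothesis that q is finite
  matters for continuity in time: the L_q norm of an input over intervals shrinking to a point tends
  to zero, and through truncation this also serves p infinite.\<close>

lemma complete_measure_lebesgue_on:
  assumes "S \<in> sets lebesgue"
  shows "complete_measure (lebesgue_on S)"
proof
  fix A B assume "B \<subseteq> A" "A \<in> null_sets (lebesgue_on S)"
  then have "B \<in> null_sets lebesgue" "B \<subseteq> S"
    using assms completion.complete2[of B A] by (auto simp: null_sets_restrict_space)
  then show "B \<in> sets (lebesgue_on S)"
    using assms by (auto simp: sets_restrict_space_iff)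
qed

text \<open>Preimages of a set under the two functions differ by part of a null set, which
  completeness makes measurable. This absorbs the exceptional sets that come with limits almost
  everywhere.\<close>

lemma (in complete_measure) borel_measurable_AE_eq:
  assumes f: "f \<in> borel_measurable M" and eq: "AE x in M. f x = g x"
  shows "g \<in> borel_measurable M"
proof (rule measurableI)
  fix A :: "'b set" assume A: "A \<in> sets borel"
  have "AE x in M. x \<in> f -` A \<inter> space M \<longleftrightarrow> x \<in> g -` A \<inter> space M"
    using eq by eventually_elim auto
  then show "g -` A \<inter> space M \<in> sets M"
    using measurable_sets[OF f A] by (rule in_sets_AE) auto
qed auto

text \<open>Without separability a difference of Borel functions can fail to be Borel. A simple
  function has finitely many values, so here the difference is patched together from finitely many
  translates of \<open>f\<close>.\<close>

lemma borel_measurable_diff_simple_function: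
  fixes f s :: "'a \<Rightarrow> 'b::real_normed_vector"
  assumes f: "f \<in> borel_measurable M" and s: "simple_function M s"
  shows "(\<lambda>x. f x - s x) \<in> borel_measurable M"
proof (rule measurable_compose_countable'[where f = "\<lambda>c x. f x - c" and I = "s ` space M"])
  show "(\<lambda>x. f x - c) \<in> borel_measurable M" for c
    by (rule measurable_compose[OF f])
       (intro borel_measurable_continuous_onI continuous_intros)
  show "s \<in> measurable M (count_space (s ` space M))"
    using s by (intro measurable_count_space_eq2[THEN iffD2]) (auto simp: simple_function_def)
  show "countable (s ` space M)"
    using s by (auto simp: simple_function_def intro: countable_finite)
qed

lemma borel_measurable_norm_diff_simple_function:
  fixes f s :: "'a \<Rightarrow> 'b::real_normed_vector"
  assumes "f \<in> borel_measurable M" and "simple_function M s"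
  shows "(\<lambda>x. norm (f x - s x)) \<in> borel_measurable M"
  by (rule measurable_compose[OF borel_measurable_diff_simple_function[OF assms]])
     (intro borel_measurable_continuous_onI continuous_intros)

text \<open>Measurability of \<open>h\<close> is a hypothesis because it can fail for a sum of Borel
  functions. Equality only almost everywhere leaves room for the endpoints at which two intervals of
  integration meet.\<close>

lemma has_vec_integral_add:
  assumes f: "has_vec_integral M f I" and g: "has_vec_integral M g J"
    and h: "h \<in> borel_measurable M" and eq: "AE x in M. h x = f x + g x"
  shows "has_vec_integral M h (I + J)"
proof -
  obtain s where s: "\<And>i::nat. Bochner_Integration.simple_bochner_integrable M (s i)"
    and sf: "(\<lambda>i. \<integral>\<^sup>+x. ennreal (norm (f x - s i x)) \<partial>M) \<longlonglongrightarrow> 0"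
    and sI: "(\<lambda>i. Bochner_Integration.simple_bochner_integral M (s i)) \<longlonglongrightarrow> I"
    and f_borel: "f \<in> borel_measurable M"
    using f by (auto simp: has_vec_integral_def)
  obtain t where t: "\<And>i::nat. Bochner_Integration.simple_bochner_integrable M (t i)"
    and tg: "(\<lambda>i. \<integral>\<^sup>+x. ennreal (norm (g x - t i x)) \<partial>M) \<longlonglongrightarrow> 0"
    and tJ: "(\<lambda>i. Bochner_Integration.simple_bochner_integral M (t i)) \<longlonglongrightarrow> J"
    and g_borel: "g \<in> borel_measurable M"
    using g by (auto simp: has_vec_integral_def)
  have simple: "simple_function M (s i)" "simple_function M (t i)" for i
    using s[of i] t[of i] by (auto elim: simple_bochner_integrable.cases)
  note [measurable] =
    borel_measurable_norm_diff_simple_function[OF f_borel simple(1)]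
    borel_measurable_norm_diff_simple_function[OF g_borel simple(2)]
  have le: "(\<integral>\<^sup>+x. ennreal (norm (h x - (s i x + t i x))) \<partial>M) \<le>
      (\<integral>\<^sup>+x. ennreal (norm (f x - s i x)) \<partial>M) + (\<integral>\<^sup>+x. ennreal (norm (g x - t i x)) \<partial>M)" for i
  proof -
    have "(\<integral>\<^sup>+x. ennreal (norm (h x - (s i x + t i x))) \<partial>M) \<le>
        (\<integral>\<^sup>+x. ennreal (norm (f x - s i x)) + ennreal (norm (g x - t i x)) \<partial>M)"
    proof (rule nn_integral_mono_AE)
      show "AE x in M. ennreal (norm (h x - (s i x + t i x))) \<le>
          ennreal (norm (f x - s i x)) + ennreal (norm (g x - t i x))"
        using eq
      proof eventually_elim
        case (elim x)
        show ?case
          unfolding elim ennreal_plus[OF norm_ge_zero norm_ge_zero, symmetric]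
          by (intro ennreal_leI norm_diff_triangle_ineq)
      qed
    qed
    then show ?thesis
      by (simp add: nn_integral_add)
  qed
  have lim: "(\<lambda>i. \<integral>\<^sup>+x. ennreal (norm (h x - (s i x + t i x))) \<partial>M) \<longlonglongrightarrow> 0"
    by (rule tendsto_sandwich[OF _ _ tendsto_const tendsto_add[OF sf tg, simplified]])
       (auto simp: le)
  show ?thesis
    unfolding has_vec_integral_def
  proof (intro conjI h exI[of _ "\<lambda>i x. s i x + t i x"] allI)
    show "Bochner_Integration.simple_bochner_integrable M (\<lambda>x. s i x + t i x)" for i
      by (rule simple_bochner_integrable_compose2[OF _ s t]) simp
    show "(\<lambda>i. Bochner_Integration.simple_bochner_integral M (\<lambda>x. s i x + t i x)) \<longlonglongrightarrow> I + J"
      using tendsto_add[OF sI tJ] by (simp add: simple_bochner_integral_add s t)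
  qed (rule lim)
qed

lemma has_vec_integral_bounded_linear:
  assumes L: "bounded_linear L" and f: "has_vec_integral M f I"
  shows "has_vec_integral M (\<lambda>x. L (f x)) (L I)"
proof -
  interpret L: bounded_linear L by fact
  obtain s where s: "\<And>i::nat. Bochner_Integration.simple_bochner_integrable M (s i)"
    and sf: "(\<lambda>i. \<integral>\<^sup>+x. ennreal (norm (f x - s i x)) \<partial>M) \<longlonglongrightarrow> 0"
    and sI: "(\<lambda>i. Bochner_Integration.simple_bochner_integral M (s i)) \<longlonglongrightarrow> I"
    and f_borel: "f \<in> borel_measurable M"
    using f by (auto simp: has_vec_integral_def)
  have simple: "simple_function M (s i)" for i
    using s[of i] by (auto elim: simple_bochner_integrable.cases)
  note [measurable] = borel_measurable_norm_diff_simple_function[OF f_borel simple]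
  obtain K where K: "\<And>x. norm (L x) \<le> norm x * K" "0 < K"
    using L.pos_bounded by blast
  have le: "(\<integral>\<^sup>+x. ennreal (norm (L (f x) - L (s i x))) \<partial>M) \<le>
      ennreal K * (\<integral>\<^sup>+x. ennreal (norm (f x - s i x)) \<partial>M)" for i
  proof -
    have "(\<integral>\<^sup>+x. ennreal (norm (L (f x) - L (s i x))) \<partial>M) \<le>
        (\<integral>\<^sup>+x. ennreal K * ennreal (norm (f x - s i x)) \<partial>M)"
      using K by (intro nn_integral_mono)
        (simp add: L.diff[symmetric] ennreal_mult[symmetric] mult.commute[of K])
    then show ?thesis
      by (simp add: nn_integral_cmult)
  qed
  have lim0: "(\<lambda>i. ennreal K * (\<integral>\<^sup>+x. ennreal (norm (f x - s i x)) \<partial>M)) \<longlonglongrightarrow> 0"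
    using ennreal_tendsto_cmult[OF _ sf, of "ennreal K"] by simp
  have lim: "(\<lambda>i. \<integral>\<^sup>+x. ennreal (norm (L (f x) - L (s i x))) \<partial>M) \<longlonglongrightarrow> 0"
    by (rule tendsto_sandwich[OF _ _ tendsto_const lim0]) (auto simp: le)
  show ?thesis
    unfolding has_vec_integral_def
  proof (intro conjI exI[of _ "\<lambda>i x. L (s i x)"] allI)
    show "(\<lambda>x. L (f x)) \<in> borel_measurable M"
      by (rule measurable_compose[OF f_borel borel_measurable_continuous_onI])
         (rule linear_continuous_on[OF L])
    show "Bochner_Integration.simple_bochner_integrable M (\<lambda>x. L (s i x))" for i
      by (rule simple_bochner_integrable_compose2[where p = "\<lambda>x y. L x", OF _ s s]) (rule L.zero)
    show "(\<lambda>i. Bochner_Integration.simple_bochner_integral M (\<lambda>x. L (s i x))) \<longlonglongrightarrow> L I"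
      using L.tendsto[OF sI] by (simp add: simple_bochner_integral_linear[OF L.linear s])
  qed (rule lim)
qed

lemma has_vec_integral_norm_le:
  assumes f: "has_vec_integral M f I"
  shows "ennreal (norm I) \<le> (\<integral>\<^sup>+x. ennreal (norm (f x)) \<partial>M)"
proof -
  obtain s where s: "\<And>i::nat. Bochner_Integration.simple_bochner_integrable M (s i)"
    and sf: "(\<lambda>i. \<integral>\<^sup>+x. ennreal (norm (f x - s i x)) \<partial>M) \<longlonglongrightarrow> 0"
    and sI: "(\<lambda>i. Bochner_Integration.simple_bochner_integral M (s i)) \<longlonglongrightarrow> I"
    and f_borel: "f \<in> borel_measurable M"
    using f by (auto simp: has_vec_integral_def)
  have simple: "simple_function M (s i)" for i
    using s[of i] by (auto elim: simple_bochner_integrable.cases)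
  note [measurable] = borel_measurable_norm_diff_simple_function[OF f_borel simple]
  have [measurable]: "(\<lambda>x. norm (f x)) \<in> borel_measurable M"
    by (rule measurable_compose[OF f_borel])
       (intro borel_measurable_continuous_onI continuous_intros)
  have le: "ennreal (norm (Bochner_Integration.simple_bochner_integral M (s i))) \<le>
      (\<integral>\<^sup>+x. ennreal (norm (f x)) \<partial>M) + (\<integral>\<^sup>+x. ennreal (norm (f x - s i x)) \<partial>M)" for i
  proof -
    have "ennreal (norm (Bochner_Integration.simple_bochner_integral M (s i))) \<le>
        ennreal (Bochner_Integration.simple_bochner_integral M (\<lambda>x. norm (s i x)))"
      by (intro ennreal_leI simple_bochner_integral_norm_bound s)
    also have "\<dots> = (\<integral>\<^sup>+x. ennreal (norm (s i x)) \<partial>M)"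
      by (intro simple_bochner_integral_eq_nn_integral
          simple_bochner_integrable_compose2[where p = "\<lambda>x y. norm x", OF _ s s]) auto
    also have "\<dots> \<le> (\<integral>\<^sup>+x. ennreal (norm (f x)) + ennreal (norm (f x - s i x)) \<partial>M)"
      by (intro nn_integral_mono)
         (metis ennreal_leI ennreal_plus norm_ge_zero norm_minus_commute norm_triangle_sub)
    finally show ?thesis
      by (simp add: nn_integral_add)
  qed
  show ?thesis
  proof (rule LIMSEQ_le)
    show "(\<lambda>i. ennreal (norm (Bochner_Integration.simple_bochner_integral M (s i)))) \<longlonglongrightarrow> ennreal (norm I)"
      by (intro tendsto_ennrealI tendsto_norm sI)
    show "(\<lambda>i. (\<integral>\<^sup>+x. ennreal (norm (f x)) \<partial>M) + (\<integral>\<^sup>+x. ennreal (norm (f x - s i x)) \<partial>M))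
        \<longlonglongrightarrow> (\<integral>\<^sup>+x. ennreal (norm (f x)) \<partial>M)"
      using tendsto_add[OF tendsto_const sf] by simp
  qed (use le in auto)
qed

text \<open>Adding the integral \<open>I + J\<close> of \<open>h\<close> to the integral
  \<open>- K\<close> of \<open>- h\<close> exhibits \<open>I + J - K\<close> as an integral of the
  zero function, so the norm estimate makes it vanish.\<close>

lemma has_vec_integral_sum_eq:
  assumes f: "has_vec_integral M f I" and g: "has_vec_integral M g J"
    and h: "has_vec_integral M h K" and eq: "AE x in M. h x = f x + g x"
  shows "K = I + J"
proof -
  have "has_vec_integral M h (I + J)"
    using f g _ eq by (rule has_vec_integral_add) (use h in \<open>simp add: has_vec_integral_def\<close>)
  moreover have "has_vec_integral M (\<lambda>x. (-1) *\<^sub>R h x) ((-1) *\<^sub>R K)"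
    using h by (intro has_vec_integral_bounded_linear[OF bounded_linear_scaleR_right])
  ultimately have "has_vec_integral M (\<lambda>_. 0) (I + J + (-1) *\<^sub>R K)"
    by (rule has_vec_integral_add) auto
  from has_vec_integral_norm_le[OF this] have "norm (I + J - K) \<le> 0"
    by simp
  then show ?thesis by simp
qed

lemma has_vec_integral_unique:
  assumes "has_vec_integral M f I" and "has_vec_integral M f J"
  shows "I = J"
proof -
  have "has_vec_integral M (\<lambda>x. 0 *\<^sub>R f x) (0 *\<^sub>R I)"
    using assms(1) by (intro has_vec_integral_bounded_linear[OF bounded_linear_scaleR_right])
  from has_vec_integral_sum_eq[OF this assms(2,1)] show ?thesis by simp
qed

lemma has_vec_integral_cong:
  assumes "\<And>x. x \<in> space M \<Longrightarrow> f x = g x"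
  shows "has_vec_integral M f I \<longleftrightarrow> has_vec_integral M g I"
proof -
  have "f \<in> borel_measurable M \<longleftrightarrow> g \<in> borel_measurable M"
    using assms by (rule measurable_cong)
  moreover have "(\<integral>\<^sup>+x. ennreal (norm (f x - s x)) \<partial>M) = (\<integral>\<^sup>+x. ennreal (norm (g x - s x)) \<partial>M)" for s
    using assms by (intro nn_integral_cong) simp
  ultimately show ?thesis
    unfolding has_vec_integral_def by simp
qed

text \<open>Moves integrals over intervals to the whole line, where translations act.\<close>

lemma has_vec_integral_restrict_space:
  assumes S: "S \<inter> space M \<in> sets M"
  shows "has_vec_integral (restrict_space M S) f I \<longleftrightarrow>
    has_vec_integral M (\<lambda>x. indicator S x *\<^sub>R f x) I" (is "?L \<longleftrightarrow> ?R")
proof -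
  let ?i = "\<lambda>s x. indicator S x *\<^sub>R s x"
  note restrict = borel_measurable_restrict_space_iff[OF S]
    simple_bochner_integrable_restrict_space[OF S] nn_integral_restrict_space[OF S]
  have borel: "f \<in> borel_measurable (restrict_space M S) \<longleftrightarrow> ?i f \<in> borel_measurable M"
  proof
    assume f: "f \<in> borel_measurable (restrict_space M S)"
    show "?i f \<in> borel_measurable M"
    proof (rule measurable_restrict_space_iff[OF S, THEN iffD1, THEN measurable_cong[THEN iffD1, rotated]])
      show "0 \<in> space borel" by simp
      show "f \<in> borel_measurable (restrict_space M S)" by fact
    qed (auto simp: indicator_def)
  next
    assume "?i f \<in> borel_measurable M"
    then have "?i f \<in> borel_measurable (restrict_space M S)"
      by (rule measurable_restrict_space1)
    then show "f \<in> borel_measurable (restrict_space M S)"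
      by (rule measurable_cong[THEN iffD1, rotated]) (auto simp: space_restrict_space)
  qed
  have dist: "ennreal (norm (f x - s x)) * indicator S x =
      ennreal (norm (?i f x - ?i s x))" for s x
    by (simp add: indicator_def)
  show ?thesis
  proof
    assume ?L
    then obtain s where "\<And>i::nat. Bochner_Integration.simple_bochner_integrable (restrict_space M S) (s i)"
      "(\<lambda>i. \<integral>\<^sup>+x. ennreal (norm (f x - s i x)) \<partial>restrict_space M S) \<longlonglongrightarrow> 0"
      "(\<lambda>i. Bochner_Integration.simple_bochner_integral (restrict_space M S) (s i)) \<longlonglongrightarrow> I"
      and "f \<in> borel_measurable (restrict_space M S)"
      by (auto simp: has_vec_integral_def)
    then show ?R
      unfolding has_vec_integral_def
      by (intro conjI exI[of _ "\<lambda>i. ?i (s i)"])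
         (auto simp: borel[symmetric] simple_bochner_integral_restrict_space[OF S, symmetric]
           simple_bochner_integrable_restrict_space[OF S, symmetric] dist[symmetric]
           nn_integral_restrict_space[OF S, symmetric])
  next
    assume ?R
    then obtain s where s: "\<And>i::nat. Bochner_Integration.simple_bochner_integrable M (s i)"
      and sf: "(\<lambda>i. \<integral>\<^sup>+x. ennreal (norm (?i f x - s i x)) \<partial>M) \<longlonglongrightarrow> 0"
      and sI: "(\<lambda>i. Bochner_Integration.simple_bochner_integral M (s i)) \<longlonglongrightarrow> I"
      and f: "?i f \<in> borel_measurable M"
      by (auto simp: has_vec_integral_def)
    have simple: "simple_function M (s i)" for i
      using s[of i] by (auto elim: simple_bochner_integrable.cases)
    note [measurable] = borel_measurable_norm_diff_simple_function[OF f simple]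
    have int: "Bochner_Integration.simple_bochner_integrable (restrict_space M S) (s i)" for i
    proof -
      have "simple_function M (\<lambda>x. indicator S x *\<^sub>R s i x)"
        using simple_function_compose2[OF simple_function_indicator[OF S] simple[of i], of scaleR]
        by (rule simple_function_cong[THEN iffD1, rotated]) (simp add: indicator_def)
      moreover have "emeasure M {x \<in> space M. indicator S x *\<^sub>R s i x \<noteq> 0} \<le>
          emeasure M {x \<in> space M. s i x \<noteq> 0}"
        using simple_functionD(2)[OF simple[of i], of "- {0}"]
        by (intro emeasure_mono) (auto simp: vimage_def Int_def conj_commute)
      ultimately have "Bochner_Integration.simple_bochner_integrable M (\<lambda>x. indicator S x *\<^sub>R s i x)"
        using s[of i] by (auto simp: simple_bochner_integrable.simps top_unique)
      then show ?thesis by (simp add: restrict)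
    qed
    \<comment> \<open>Approximants on the whole space may be nonzero off \<open>S\<close>, where the
      target vanishes. There their norm equals the approximation error, so cutting them down to
      \<open>S\<close> does not change the limit of the integrals.\<close>
    have outside: "(\<lambda>i. Bochner_Integration.simple_bochner_integral M (s i) -
        Bochner_Integration.simple_bochner_integral M (?i (s i))) \<longlonglongrightarrow> 0"
    proof (rule tendsto_norm_zero_cancel, rule tendsto_ennrealD[where x = 0])
      have "ennreal (norm (Bochner_Integration.simple_bochner_integral M (s i) - Bochner_Integration.simple_bochner_integral M (?i (s i))))
          \<le> (\<integral>\<^sup>+x. ennreal (norm (?i f x - s i x)) \<partial>M)" for i
      proof -
        have int': "Bochner_Integration.simple_bochner_integrable M (?i (s i))"
          using int[of i] by (simp add: restrict)
        have diff: "Bochner_Integration.simple_bochner_integrable M (\<lambda>x. s i x - ?i (s i) x)"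
          by (rule simple_bochner_integrable_compose2[OF _ s int']) simp
        have "norm (Bochner_Integration.simple_bochner_integral M (s i) - Bochner_Integration.simple_bochner_integral M (?i (s i))) \<le>
            Bochner_Integration.simple_bochner_integral M (\<lambda>x. norm (s i x - ?i (s i) x))"
          using simple_bochner_integral_norm_bound[OF diff]
          by (simp add: simple_bochner_integral_diff[OF s int'])
        then have "ennreal (norm (Bochner_Integration.simple_bochner_integral M (s i) - Bochner_Integration.simple_bochner_integral M (?i (s i))))
            \<le> ennreal (Bochner_Integration.simple_bochner_integral M (\<lambda>x. norm (s i x - ?i (s i) x)))"
          by (rule ennreal_leI)
        also have "\<dots> = (\<integral>\<^sup>+x. ennreal (norm (s i x - ?i (s i) x)) \<partial>M)"
          by (intro simple_bochner_integral_eq_nn_integral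
              simple_bochner_integrable_compose2[where p = "\<lambda>x y. norm x", OF _ diff diff]) auto
        also have "\<dots> \<le> (\<integral>\<^sup>+x. ennreal (norm (?i f x - s i x)) \<partial>M)"
          by (intro nn_integral_mono) (auto simp: indicator_def)
        finally show ?thesis .
      qed
      then show "(\<lambda>i. ennreal (norm (Bochner_Integration.simple_bochner_integral M (s i) -
          Bochner_Integration.simple_bochner_integral M (?i (s i))))) \<longlonglongrightarrow> ennreal 0"
        unfolding ennreal_0 by (intro tendsto_sandwich[OF _ _ tendsto_const sf]) auto
    qed auto
    have "(\<lambda>i. Bochner_Integration.simple_bochner_integral M (?i (s i))) \<longlonglongrightarrow> I"
      using tendsto_diff[OF sI outside] by simp
    moreover have "(\<integral>\<^sup>+x. ennreal (norm (?i f x - ?i (s i) x)) \<partial>M) \<le>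
        (\<integral>\<^sup>+x. ennreal (norm (?i f x - s i x)) \<partial>M)" for i
      by (intro nn_integral_mono) (auto simp: indicator_def)
    then have "(\<lambda>i. \<integral>\<^sup>+x. ennreal (norm (?i f x - ?i (s i) x)) \<partial>M) \<longlonglongrightarrow> 0"
      by (intro tendsto_sandwich[OF _ _ tendsto_const sf]) auto
    ultimately show ?L
      unfolding has_vec_integral_def
      using f int by (intro conjI exI[of _ s])
         (auto simp: borel simple_bochner_integral_restrict_space[OF S]
           dist nn_integral_restrict_space[OF S])
  qed
qed

lemma has_vec_integral_zero: "has_vec_integral M (\<lambda>_. 0) 0"
proof -
  have "Bochner_Integration.simple_bochner_integrable M (\<lambda>_. 0 :: 'b)"
    by (simp add: simple_bochner_integrable.simps)
  moreover have "Bochner_Integration.simple_bochner_integral M (\<lambda>_. 0 :: 'b) = 0"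
    unfolding simple_bochner_integral_def by (rule sum.neutral) auto
  ultimately show ?thesis
    unfolding has_vec_integral_def by (intro conjI exI[of _ "\<lambda>_ _. 0"]) auto
qed

lemma AE_lebesgue_singleton: "AE x in lebesgue. x \<noteq> (c::real)"
  by (rule AE_completion) (rule AE_lborel_singleton)

section \<open>Image measures and translations of the line\<close>

lemma simple_bochner_integrable_distr:
  assumes g: "g \<in> measurable M N"
    and s: "Bochner_Integration.simple_bochner_integrable (distr M N g) s"
  shows "Bochner_Integration.simple_bochner_integrable M (\<lambda>x. s (g x))"
    and "Bochner_Integration.simple_bochner_integral M (\<lambda>x. s (g x)) =
      Bochner_Integration.simple_bochner_integral (distr M N g) s"
proof -
  have simple: "simple_function N s"
    and fin: "emeasure (distr M N g) {x \<in> space N. s x \<noteq> 0} \<noteq> \<infinity>"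
    using s by (auto simp: simple_bochner_integrable.simps simple_function_def)
  have finite: "finite (s ` space N)"
    using simple by (rule simple_functionD)
  have meas: "{x \<in> space N. P (s x)} \<in> sets N" for P
  proof -
    have "{x \<in> space N. P (s x)} = (\<Union>y\<in>{y \<in> s ` space N. P y}. s -` {y} \<inter> space N)"
      by auto
    also have "\<dots> \<in> sets N"
      using finite by (intro sets.finite_UN) (auto intro: simple_functionD[OF simple])
    finally show ?thesis .
  qed
  have em: "emeasure (distr M N g) {x \<in> space N. P (s x)} = emeasure M {x \<in> space M. P (s (g x))}" for P
    using measurable_space[OF g]
    by (subst emeasure_distr[OF g meas]) (auto intro!: arg_cong[where f = "emeasure M"])
  have sub: "(\<lambda>x. s (g x)) ` space M \<subseteq> s ` space N"
    using measurable_space[OF g] by auto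
  have "simple_function M (\<lambda>x. s (g x))"
    unfolding simple_function_def
  proof (intro conjI ballI)
    show "finite ((\<lambda>x. s (g x)) ` space M)"
      using sub finite by (rule finite_subset)
    fix y
    have "(\<lambda>x. s (g x)) -` {y} \<inter> space M = g -` {x \<in> space N. s x = y} \<inter> space M"
      using measurable_space[OF g] by auto
    also have "\<dots> \<in> sets M"
      by (intro measurable_sets[OF g] meas)
    finally show "(\<lambda>x. s (g x)) -` {y} \<inter> space M \<in> sets M" .
  qed
  with fin show "Bochner_Integration.simple_bochner_integrable M (\<lambda>x. s (g x))"
    using em[of "\<lambda>y. y \<noteq> 0"] by (simp add: simple_bochner_integrable.simps)
  have "Bochner_Integration.simple_bochner_integral (distr M N g) s =
      (\<Sum>y\<in>s ` space N. measure M {x \<in> space M. s (g x) = y} *\<^sub>R y)"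
    unfolding simple_bochner_integral_def measure_def
    using em[of "\<lambda>z. z = y" for y] by (intro sum.cong) auto
  \<comment> \<open>Values of \<open>s\<close> that are never reached through \<open>g\<close> have
    empty level sets and contribute nothing.\<close>
  also have "\<dots> = (\<Sum>y\<in>(\<lambda>x. s (g x)) ` space M. measure M {x \<in> space M. s (g x) = y} *\<^sub>R y)"
  proof (rule sum.mono_neutral_right[OF finite sub], rule ballI)
    fix y assume "y \<in> s ` space N - (\<lambda>x. s (g x)) ` space M"
    then have "{x \<in> space M. s (g x) = y} = {}" by blast
    then show "measure M {x \<in> space M. s (g x) = y} *\<^sub>R y = 0"
      by (simp only: measure_empty scaleR_zero_left)
  qed
  finally show "Bochner_Integration.simple_bochner_integral M (\<lambda>x. s (g x)) =
      Bochner_Integration.simple_bochner_integral (distr M N g) s"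
    by (simp add: simple_bochner_integral_def)
qed

lemma has_vec_integral_distr:
  assumes g: "g \<in> measurable M N" and f: "has_vec_integral (distr M N g) f I"
  shows "has_vec_integral M (\<lambda>x. f (g x)) I"
proof -
  obtain s where s: "\<And>i::nat. Bochner_Integration.simple_bochner_integrable (distr M N g) (s i)"
    and sf: "(\<lambda>i. \<integral>\<^sup>+x. ennreal (norm (f x - s i x)) \<partial>distr M N g) \<longlonglongrightarrow> 0"
    and sI: "(\<lambda>i. Bochner_Integration.simple_bochner_integral (distr M N g) (s i)) \<longlonglongrightarrow> I"
    and f_borel: "f \<in> borel_measurable (distr M N g)"
    using f by (auto simp: has_vec_integral_def)
  have simple: "simple_function (distr M N g) (s i)" for i
    using s[of i] by (auto elim: simple_bochner_integrable.cases)
  have "(\<lambda>x. norm (f x - s i x)) \<in> borel_measurable N" for i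
    using borel_measurable_norm_diff_simple_function[OF f_borel simple[of i]] by simp
  then have int: "(\<integral>\<^sup>+x. ennreal (norm (f x - s i x)) \<partial>distr M N g) =
      (\<integral>\<^sup>+x. ennreal (norm (f (g x) - s i (g x))) \<partial>M)" for i
    by (intro nn_integral_distr[OF g]) simp
  show ?thesis
    unfolding has_vec_integral_def
    using sf sI simple_bochner_integrable_distr[OF g s] measurable_compose[OF g, of f borel] f_borel
    by (intro conjI exI[of _ "\<lambda>i x. s i (g x)"]) (auto simp: int)
qed

lemma distr_lebesgue_translation: "distr lebesgue lebesgue ((+) (c::real)) = lebesgue"
  using lebesgue_real_affine[of 1 c] by (simp add: density_1)

lemma measurable_lebesgue_translation: "(+) (c::real) \<in> measurable lebesgue lebesgue"
  using lebesgue_affine_measurable[of "\<lambda>_. 1" c] by simp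

lemma AE_lebesgue_translation:
  assumes "AE x in lebesgue. P (x::real)"
  shows "AE x in lebesgue. P (c + x)"
proof -
  obtain N where N: "N \<in> null_sets lebesgue" "\<And>x. x \<notin> N \<Longrightarrow> P x"
    using assms by (rule AE_E3) simp
  then have "emeasure (distr lebesgue lebesgue ((+) c)) N = 0"
    by (simp add: distr_lebesgue_translation null_setsD1)
  with N have "(+) c -` N \<in> null_sets lebesgue"
    using measurable_sets[OF measurable_lebesgue_translation, of N c]
    by (auto simp: emeasure_distr[OF measurable_lebesgue_translation] intro!: null_setsI)
  then show ?thesis
  proof (rule AE_I')
    show "{x \<in> space lebesgue. \<not> P (c + x)} \<subseteq> (+) c -` N"
      using N(2) by blast
  qed
qed

lemma has_vec_integral_translation:
  "has_vec_integral lebesgue f I \<Longrightarrow> has_vec_integral lebesgue (\<lambda>x. f (c + x)) I" for c :: real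
  using has_vec_integral_distr[OF measurable_lebesgue_translation] by (simp add: distr_lebesgue_translation)

section \<open>Strong measurability\<close>

text \<open>The values of all the approximants form a countable set. Together with
  \<open>strongly_measurable_borel\<close> and \<open>strongly_measurableI\<close> this is Pettis'
  characterisation: Borel measurable with almost separable range.\<close>

lemma strongly_measurable_separable_range:
  assumes "strongly_measurable M f"
  shows "\<exists>C. countable C \<and> (AE x in M. f x \<in> closure C)"
proof -
  obtain s where s: "\<And>i::nat. simple_function M (s i)"
    and lim: "AE x in M. (\<lambda>i. s i x) \<longlonglongrightarrow> f x"
    using assms unfolding strongly_measurable_def by blast
  let ?C = "\<Union>i. s i ` space M"
  have "countable ?C"
    using simple_functionD(1)[OF s] by (intro countable_UN) (auto intro: countable_finite)
  moreover have "AE x in M. f x \<in> closure ?C"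
    using lim AE_space
  proof eventually_elim
    case (elim x)
    have "s i x \<in> ?C" for i using elim by blast
    with elim show ?case
      unfolding closure_sequential by (intro exI[of _ "\<lambda>i. s i x"]) simp
  qed
  ultimately show ?thesis by blast
qed

lemma (in complete_measure) strongly_measurable_borel:
  assumes "strongly_measurable M f"
  shows "f \<in> borel_measurable M"
proof -
  obtain s where s: "\<And>i::nat. simple_function M (s i)"
    and lim: "AE x in M. (\<lambda>i. s i x) \<longlonglongrightarrow> f x"
    using assms by (auto simp: strongly_measurable_def)
  from lim obtain N where N: "N \<in> null_sets M" "{x \<in> space M. \<not> (\<lambda>i. s i x) \<longlonglongrightarrow> f x} \<subseteq> N"
    by (auto elim!: AE_E3)
  let ?g = "\<lambda>x. if x \<in> N then 0 else f x"
  have "?g \<in> borel_measurable M"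
  proof (rule borel_measurable_LIMSEQ_metric)
    show "(\<lambda>x. if x \<in> N then 0 else s i x) \<in> borel_measurable M" for i
      by (rule measurable_If_set)
         (use N s in \<open>auto intro: borel_measurable_simple_function\<close>)
    show "(\<lambda>i. if x \<in> N then 0 else s i x) \<longlonglongrightarrow> ?g x" if "x \<in> space M" for x
      using that N by auto
  qed
  moreover have "AE x in M. ?g x = f x"
    using AE_not_in[OF N(1)] by eventually_elim simp
  ultimately show ?thesis by (rule borel_measurable_AE_eq)
qed

text \<open>The approximating functions take, among the first \<open>i\<close> points of a dense sequence in the range,
  the one closest to the value of \<open>f\<close>.\<close>

lemma strongly_measurableI:
  fixes f :: "'a \<Rightarrow> 'b::real_normed_vector"
  assumes f: "f \<in> borel_measurable M" and C: "countable C" and range: "AE x in M. f x \<in> closure C"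
  shows "strongly_measurable M f"
proof (cases "C = {}")
  case True
  \<comment> \<open>An empty \<open>C\<close> forces the whole space to be null, so any sequence
    will do.\<close>
  then have "AE x in M. False" using range by simp
  then have "AE x in M. (\<lambda>i. 0) \<longlonglongrightarrow> f x" by eventually_elim simp
  then show ?thesis
    unfolding strongly_measurable_def by (intro exI[of _ "\<lambda>_ _. 0"]) simp
next
  case False
  define e where "e = from_nat_into C"
  have e: "range e = C"
    unfolding e_def using False C by (rule range_from_nat_into)
  define P where "P i x k \<longleftrightarrow> k \<le> i \<and> (\<forall>l\<le>i. dist (f x) (e k) \<le> dist (f x) (e l))"
    for i x and k :: nat
  \<comment> \<open>Ties between equally near points are broken by the least index, which keeps
    \<open>m i\<close> measurable; its values are at most \<open>i\<close>, so composing with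
    \<open>e\<close> gives a simple function.\<close>
  define m where "m i x = (LEAST k. P i x k)" for i x
  have "\<exists>k. P i x k" for i x
  proof -
    obtain k where "k \<in> {..i}" "\<And>l. l \<in> {..i} \<Longrightarrow> dist (f x) (e k) \<le> dist (f x) (e l)"
      using obtains_MIN[of "{..i}" "\<lambda>l. dist (f x) (e l)"] by (metis Min_le atMost_iff empty_iff finite_atMost finite_imageI imageI le0)
    then show ?thesis by (auto simp: P_def)
  qed
  then have m: "P i x (m i x)" for i x
    unfolding m_def by (rule LeastI_ex)
  have [measurable]: "(\<lambda>x. dist (f x) (e k)) \<in> borel_measurable M" for k
    by (rule measurable_compose[OF f])
       (intro borel_measurable_continuous_onI continuous_intros)
  have [measurable]: "m i \<in> measurable M (count_space UNIV)" for i
    unfolding m_def P_def by measurable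
  have simple: "simple_function M (\<lambda>x. e (m i x))" for i
  proof -
    have "simple_function M (m i)"
      unfolding simple_function_def
    proof
      show "finite (m i ` space M)"
        by (rule finite_subset[of _ "{..i}"]) (use m in \<open>auto simp: P_def\<close>)
    qed auto
    then show ?thesis by (rule simple_function_compose1)
  qed
  have "(\<lambda>i. e (m i x)) \<longlonglongrightarrow> f x" if dense: "f x \<in> closure C" for x
  proof (rule metric_LIMSEQ_I)
    fix \<epsilon> :: real assume "0 < \<epsilon>"
    then obtain y where "y \<in> C" "dist y (f x) < \<epsilon>"
      using dense unfolding closure_approachable by blast
    then obtain k where k: "dist (e k) (f x) < \<epsilon>"
      unfolding e[symmetric] by blast
    have "dist (e (m i x)) (f x) < \<epsilon>" if "k \<le> i" for i
      using m[of i x] that k by (auto simp: P_def dist_commute intro: le_less_trans)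
    then show "\<exists>n0. \<forall>i\<ge>n0. dist (e (m i x)) (f x) < \<epsilon>" by blast
  qed
  with range have "AE x in M. (\<lambda>i. e (m i x)) \<longlonglongrightarrow> f x" by auto
  with simple show ?thesis
    unfolding strongly_measurable_def by (intro exI[of _ "\<lambda>i x. e (m i x)"]) simp
qed

text \<open>The separable-range characterisation avoids a diagonal choice of simple functions: a
  limit of the \<open>v n\<close> lies in the closure of the countable union of their dense
  sets.\<close>

lemma (in complete_measure) strongly_measurable_LIMSEQ:
  fixes f :: "'a \<Rightarrow> 'b::real_normed_vector"
  assumes v: "\<And>n::nat. strongly_measurable M (v n)" and lim: "AE x in M. (\<lambda>n. v n x) \<longlonglongrightarrow> f x"
  shows "strongly_measurable M f"
proof -
  obtain C where C: "\<And>n. countable (C n)" "\<And>n. AE x in M. v n x \<in> closure (C n)"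
    using strongly_measurable_separable_range[OF v] by metis
  show ?thesis
  proof (rule strongly_measurableI)
    show "countable (\<Union>n. C n)"
      using C by blast
    have "AE x in M. \<forall>n. v n x \<in> closure (C n)"
      using C by (simp add: AE_all_countable)
    with lim show "AE x in M. f x \<in> closure (\<Union>n. C n)"
    proof eventually_elim
      case (elim x)
      have "v n x \<in> closure (\<Union>n. C n)" for n
        using elim(2) closure_mono[of "C n" "\<Union>n. C n"] by blast
      from closed_closure this elim(1) show ?case by (rule closed_sequentially)
    qed
    from lim obtain N where N: "N \<in> null_sets M" "{x \<in> space M. \<not> (\<lambda>n. v n x) \<longlonglongrightarrow> f x} \<subseteq> N"
      by (auto elim!: AE_E3)
    let ?g = "\<lambda>x. if x \<in> N then 0 else f x"
    have "?g \<in> borel_measurable M"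
    proof (rule borel_measurable_LIMSEQ_metric)
      show "(\<lambda>x. if x \<in> N then 0 else v i x) \<in> borel_measurable M" for i
        by (rule measurable_If_set)
           (use N v in \<open>auto intro: strongly_measurable_borel\<close>)
      show "(\<lambda>i. if x \<in> N then 0 else v i x) \<longlonglongrightarrow> ?g x" if "x \<in> space M" for x
        using that N by auto
    qed
    moreover have "AE x in M. ?g x = f x"
      using AE_not_in[OF N(1)] by eventually_elim simp
    ultimately show "f \<in> borel_measurable M" by (rule borel_measurable_AE_eq)
  qed
qed

lemma strongly_measurable_add:
  assumes "strongly_measurable M f" and "strongly_measurable M g"
  shows "strongly_measurable M (\<lambda>x. f x + g x)"
proof -
  obtain s t where s: "\<And>i::nat. simple_function M (s i)" "AE x in M. (\<lambda>i. s i x) \<longlonglongrightarrow> f x"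
    and t: "\<And>i::nat. simple_function M (t i)" "AE x in M. (\<lambda>i. t i x) \<longlonglongrightarrow> g x"
    using assms by (auto simp: strongly_measurable_def)
  have "AE x in M. (\<lambda>i. s i x + t i x) \<longlonglongrightarrow> f x + g x"
    using s(2) t(2) by eventually_elim (rule tendsto_add)
  moreover have "simple_function M (\<lambda>x. s i x + t i x)" for i
    by (rule simple_function_compose2) (rule s t)+
  ultimately show ?thesis
    unfolding strongly_measurable_def by (intro exI[of _ "\<lambda>i x. s i x + t i x"]) simp
qed

lemma strongly_measurable_scaleR:
  fixes f :: "'a \<Rightarrow> 'b::real_normed_vector"
  assumes f: "strongly_measurable M f" and c: "c \<in> borel_measurable M"
  shows "strongly_measurable M (\<lambda>x. c x *\<^sub>R f x)"
proof -
  obtain s where s: "\<And>i::nat. simple_function M (s i)" "AE x in M. (\<lambda>i. s i x) \<longlonglongrightarrow> f x"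
    using f by (auto simp: strongly_measurable_def)
  obtain d where d: "\<And>i::nat. simple_function M (d i)"
    "\<And>x. x \<in> space M \<Longrightarrow> (\<lambda>i. d i x) \<longlonglongrightarrow> c x"
    using borel_measurable_implies_sequence_metric[OF c] by metis
  have "AE x in M. (\<lambda>i. d i x *\<^sub>R s i x) \<longlonglongrightarrow> c x *\<^sub>R f x"
    using s(2) AE_space by eventually_elim (intro tendsto_scaleR d(2))
  moreover have "simple_function M (\<lambda>x. d i x *\<^sub>R s i x)" for i
    by (rule simple_function_compose2) (rule s d)+
  ultimately show ?thesis
    unfolding strongly_measurable_def by (intro exI[of _ "\<lambda>i x. d i x *\<^sub>R s i x"]) simp
qed

lemma strongly_measurable_cong:
  assumes "\<And>x. x \<in> space M \<Longrightarrow> f x = g x"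
  shows "strongly_measurable M f \<longleftrightarrow> strongly_measurable M g"
proof -
  have "(AE x in M. (\<lambda>i. s i x) \<longlonglongrightarrow> f x) \<longleftrightarrow> (AE x in M. (\<lambda>i. s i x) \<longlonglongrightarrow> g x)" for s :: "nat \<Rightarrow> _"
    using assms by (intro AE_cong) simp
  then show ?thesis unfolding strongly_measurable_def by simp
qed

lemma strongly_measurable_restrict_space:
  fixes f :: "'a \<Rightarrow> 'b::real_normed_vector"
  assumes S: "S \<inter> space M \<in> sets M"
  shows "strongly_measurable (restrict_space M S) f \<longleftrightarrow>
    strongly_measurable M (\<lambda>x. indicator S x *\<^sub>R f x)" (is "?L \<longleftrightarrow> ?R")
proof
  assume ?L
  then obtain s where s: "\<And>i::nat. simple_function (restrict_space M S) (s i)"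
    and lim: "AE x in restrict_space M S. (\<lambda>i. s i x) \<longlonglongrightarrow> f x"
    unfolding strongly_measurable_def by blast
  have "AE x in M. (\<lambda>i. indicator S x *\<^sub>R s i x) \<longlonglongrightarrow> indicator S x *\<^sub>R f x"
    using lim unfolding AE_restrict_space_iff[OF S] by eventually_elim (auto simp: indicator_def)
  with s show ?R
    unfolding strongly_measurable_def simple_function_restrict_space[OF S]
    by (intro exI[of _ "\<lambda>i x. indicator S x *\<^sub>R s i x"]) simp
next
  assume ?R
  then obtain s where s: "\<And>i::nat. simple_function M (s i)"
    and lim: "AE x in M. (\<lambda>i. s i x) \<longlonglongrightarrow> indicator S x *\<^sub>R f x"
    unfolding strongly_measurable_def by blast
  have "simple_function M (\<lambda>x. indicator S x *\<^sub>R s i x)" for i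
    using simple_function_compose2[OF simple_function_indicator[OF S] s[of i], of scaleR]
    by (rule simple_function_cong[THEN iffD1, rotated]) (simp add: indicator_def)
  then have "simple_function (restrict_space M S) (s i)" for i
    by (simp add: simple_function_restrict_space[OF S])
  moreover have "AE x in restrict_space M S. (\<lambda>i. s i x) \<longlonglongrightarrow> f x"
    using lim unfolding AE_restrict_space_iff[OF S] by eventually_elim (auto simp: indicator_def)
  ultimately show ?L
    unfolding strongly_measurable_def by (intro exI[of _ s]) simp
qed

lemma strongly_measurable_translation:
  fixes f :: "real \<Rightarrow> 'b::real_normed_vector"
  assumes "strongly_measurable lebesgue f"
  shows "strongly_measurable lebesgue (\<lambda>x. f (c + x))"
proof -
  obtain s where s: "\<And>i::nat. simple_function lebesgue (s i)"
    and lim: "AE x in lebesgue. (\<lambda>i. s i x) \<longlonglongrightarrow> f x"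
    using assms unfolding strongly_measurable_def by blast
  have "simple_function lebesgue (\<lambda>x. s i (c + x))" for i
  proof -
    have "finite (range (\<lambda>x. s i (c + x)))"
      by (rule finite_subset[OF _ simple_functionD(1)[OF s[of i]]]) auto
    moreover have "(\<lambda>x. s i (c + x)) -` {y} \<in> sets lebesgue" for y
      using measurable_sets[OF measurable_lebesgue_translation simple_functionD(2)[OF s[of i]], of c "{y}"]
      by (simp add: vimage_def)
    ultimately show ?thesis
      by (simp add: simple_function_def)
  qed
  with AE_lebesgue_translation[OF lim, of c] show ?thesis
    unfolding strongly_measurable_def by (intro exI[of _ "\<lambda>i x. s i (c + x)"]) simp
qed

section \<open>Lebesgue spaces\<close>

lemma convex_on_powr_nonneg:
  fixes p :: real
  assumes p: "1 \<le> p"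
  shows "convex_on {0..} (\<lambda>x. x powr p)"
proof (rule convex_onI)
  \<comment> \<open>If one of the two points is 0, convexity reduces to the fact that raising a
    number in (0, 1) to a power at least 1 does not increase it.\<close>
  have edge: "((1 - t) * y) powr p \<le> (1 - t) * y powr p" if "0 < t" "t < 1" "0 \<le> y" for t y :: real
  proof -
    have "(1 - t) powr p \<le> (1 - t) powr 1"
      using that p by (intro powr_mono') auto
    then show ?thesis
      using that by (simp add: powr_mult mult_right_mono)
  qed
  fix t x y :: real
  assume t: "0 < t" "t < 1" and xy: "x \<in> {0..}" "y \<in> {0..}"
  show "((1 - t) *\<^sub>R x + t *\<^sub>R y) powr p \<le> (1 - t) * x powr p + t * y powr p"
  proof (cases "x = 0 \<or> y = 0")
    case True
    then show ?thesis
      using edge[of t x] edge[of "1 - t" y] t xy by auto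
  next
    case False
    then show ?thesis
      using convex_onD[OF powr_convex[OF p], of t x y] t xy by simp
  qed
qed simp

text \<open>Convexity at \<open>x / a\<close> and \<open>y / b\<close> with weights
  \<open>a / (a + b)\<close> and \<open>b / (a + b)\<close>. If the integrals of the two powers are
  at most \<open>a powr p\<close> and \<open>b powr p\<close>, the right-hand side integrates to at
  most \<open>(a + b) powr p\<close>: this is Minkowski's inequality before integration.\<close>

lemma powr_add_le:
  fixes a b p x y :: real
  assumes p: "1 \<le> p" and ab: "0 < a" "0 < b" and xy: "0 \<le> x" "0 \<le> y"
  shows "(x + y) powr p \<le>
    (a + b) powr (p - 1) * (a powr (1 - p) * x powr p + b powr (1 - p) * y powr p)"
proof -
  define t where "t = b / (a + b)"
  have t: "0 \<le> t" "t \<le> 1" "1 - t = a / (a + b)"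
    using ab by (auto simp: t_def field_simps)
  have rescale: "s / (a + b) * (z / s) powr p =
      (a + b) powr (- 1) * (s powr (1 - p) * z powr p)" if "0 < s" "0 \<le> z" for s z
    using that ab by (simp add: powr_divide powr_diff powr_minus divide_simps)
  have "(x + y) powr p = (a + b) powr p * ((1 - t) * (x / a) + t * (y / b)) powr p"
  proof -
    have "(a + b) * ((1 - t) * (x / a)) = x" "(a + b) * (t * (y / b)) = y"
      unfolding t(3) using ab by (auto simp: t_def)
    then have "x + y = (a + b) * ((1 - t) * (x / a) + t * (y / b))"
      by (simp add: distrib_left)
    then show ?thesis
      by (simp add: powr_mult)
  qed
  also have "((1 - t) * (x / a) + t * (y / b)) powr p \<le> (1 - t) * (x / a) powr p + t * (y / b) powr p"
    using convex_onD[OF convex_on_powr_nonneg[OF p] t(1,2), of "x / a" "y / b"] ab xy by simp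
  also have "\<dots> = (a + b) powr (- 1) * (a powr (1 - p) * x powr p + b powr (1 - p) * y powr p)"
    unfolding t(3) unfolding t_def rescale[OF ab(1) xy(1)] rescale[OF ab(2) xy(2)]
    by (simp add: distrib_left)
  finally show ?thesis
    using ab by (simp add: powr_diff powr_minus divide_simps mult_left_mono)
qed

text \<open>The bound "norm at most C" as a set: one statement serves finite and infinite p, no root
  is taken, and the nonnegative integral carries finiteness with it.\<close>

definition Lp_ball :: "'a measure \<Rightarrow> ennreal \<Rightarrow> real \<Rightarrow> ('a \<Rightarrow> 'b::real_normed_vector) set" where
  "Lp_ball M p C = {f. strongly_measurable M f \<and>
     (if p = \<infinity> then AE x in M. norm (f x) \<le> C
      else (\<integral>\<^sup>+x. ennreal (norm (f x) powr enn2real p) \<partial>M) \<le> ennreal (C powr enn2real p))}"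

lemma enn2real_ge_1: "1 \<le> p \<Longrightarrow> p \<noteq> \<infinity> \<Longrightarrow> 1 \<le> enn2real p"
  using enn2real_mono[of 1 p] by (simp add: less_top)

context complete_measure
begin

lemma borel_measurable_norm:
  assumes "strongly_measurable M f"
  shows "(\<lambda>x. norm (f x)) \<in> borel_measurable M"
  by (rule measurable_compose[OF strongly_measurable_borel[OF assms]])
     (intro borel_measurable_continuous_onI continuous_intros)

lemma Lp_ball_mono_AE:
  assumes "f \<in> Lp_ball M p C" and "strongly_measurable M g" and "AE x in M. norm (g x) \<le> norm (f x)"
  shows "g \<in> Lp_ball M p C"
proof (cases "p = \<infinity>")
  case True
  have "AE x in M. norm (g x) \<le> C" if "AE x in M. norm (f x) \<le> C"
    using that assms(3) by eventually_elim simp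
  with True assms(1,2) show ?thesis by (simp add: Lp_ball_def)
next
  case False
  have "(\<integral>\<^sup>+x. ennreal (norm (g x) powr enn2real p) \<partial>M) \<le>
      (\<integral>\<^sup>+x. ennreal (norm (f x) powr enn2real p) \<partial>M)"
    using assms(3) by (intro nn_integral_mono_AE) (auto intro!: ennreal_leI powr_mono2)
  with False assms(1,2) show ?thesis by (auto simp: Lp_ball_def)
qed

text \<open>The radii are positive because negative powers of them occur in
  \<open>powr_add_le\<close>; norms equal to 0 are recovered later by enlarging the radius a
  little.\<close>

lemma Lp_ball_add:
  assumes p: "1 \<le> p" and ab: "0 < a" "0 < b" and f: "f \<in> Lp_ball M p a" and g: "g \<in> Lp_ball M p b"
  shows "(\<lambda>x. f x + g x) \<in> Lp_ball M p (a + b)"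
proof -
  have fg: "strongly_measurable M f" "strongly_measurable M g"
    using f g by (auto simp: Lp_ball_def)
  then have sum: "strongly_measurable M (\<lambda>x. f x + g x)"
    by (rule strongly_measurable_add)
  note [measurable] = fg[THEN borel_measurable_norm]
  show ?thesis
  proof (cases "p = \<infinity>")
    case True
    then have "AE x in M. norm (f x) \<le> a" "AE x in M. norm (g x) \<le> b"
      using f g by (auto simp: Lp_ball_def)
    then have "AE x in M. norm (f x + g x) \<le> a + b"
      by eventually_elim (rule norm_triangle_mono)
    with True sum show ?thesis by (simp add: Lp_ball_def)
  next
    case False
    define r where "r = enn2real p"
    have r: "1 \<le> r" unfolding r_def by (rule enn2real_ge_1[OF p False])
    have If: "(\<integral>\<^sup>+x. ennreal (norm (f x) powr r) \<partial>M) \<le> ennreal (a powr r)"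
      and Ig: "(\<integral>\<^sup>+x. ennreal (norm (g x) powr r) \<partial>M) \<le> ennreal (b powr r)"
      using f g False by (auto simp: Lp_ball_def r_def)
    let ?c = "(a + b) powr (r - 1)"
    have "(\<integral>\<^sup>+x. ennreal (norm (f x + g x) powr r) \<partial>M) \<le>
        (\<integral>\<^sup>+x. ennreal (?c * a powr (1 - r)) * ennreal (norm (f x) powr r) +
          ennreal (?c * b powr (1 - r)) * ennreal (norm (g x) powr r) \<partial>M)"
    proof (intro nn_integral_mono)
      fix x
      have "norm (f x + g x) powr r \<le> (norm (f x) + norm (g x)) powr r"
        using r by (intro powr_mono2 norm_triangle_ineq) auto
      also have "\<dots> \<le> ?c * (a powr (1 - r) * norm (f x) powr r + b powr (1 - r) * norm (g x) powr r)"
        by (intro powr_add_le r ab norm_ge_zero)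
      finally show "ennreal (norm (f x + g x) powr r) \<le>
          ennreal (?c * a powr (1 - r)) * ennreal (norm (f x) powr r) +
          ennreal (?c * b powr (1 - r)) * ennreal (norm (g x) powr r)"
        by (simp add: ennreal_mult[symmetric] ennreal_plus[symmetric] distrib_left mult.assoc
            ennreal_leI del: ennreal_plus)
    qed
    also have "\<dots> = ennreal (?c * a powr (1 - r)) * (\<integral>\<^sup>+x. ennreal (norm (f x) powr r) \<partial>M) +
          ennreal (?c * b powr (1 - r)) * (\<integral>\<^sup>+x. ennreal (norm (g x) powr r) \<partial>M)"
      by (simp add: nn_integral_add nn_integral_cmult)
    also have "\<dots> \<le> ennreal (?c * a powr (1 - r)) * ennreal (a powr r) +
          ennreal (?c * b powr (1 - r)) * ennreal (b powr r)"
      by (intro add_mono mult_left_mono If Ig) auto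
    also have "\<dots> = ennreal (?c * (a powr (1 - r) * a powr r + b powr (1 - r) * b powr r))"
      by (simp add: ennreal_mult[symmetric] ennreal_plus[symmetric] distrib_left mult.assoc
          del: ennreal_plus)
    also have "?c * (a powr (1 - r) * a powr r + b powr (1 - r) * b powr r) = (a + b) powr r"
      using ab by (simp add: powr_add[symmetric] powr_diff)
    finally show ?thesis
      using False sum by (simp add: Lp_ball_def r_def)
  qed
qed

lemma Lp_ball_scaleR:
  assumes f: "f \<in> Lp_ball M p C" and C: "0 \<le> C"
  shows "(\<lambda>x. c *\<^sub>R f x) \<in> Lp_ball M p (\<bar>c\<bar> * C)"
proof -
  have f': "strongly_measurable M f" and cf: "strongly_measurable M (\<lambda>x. c *\<^sub>R f x)"
    using f by (auto simp: Lp_ball_def intro!: strongly_measurable_scaleR)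
  note [measurable] = f'[THEN borel_measurable_norm]
  show ?thesis
  proof (cases "p = \<infinity>")
    case True
    then have "AE x in M. norm (f x) \<le> C"
      using f by (auto simp: Lp_ball_def)
    then have "AE x in M. norm (c *\<^sub>R f x) \<le> \<bar>c\<bar> * C"
      by eventually_elim (simp add: mult_left_mono)
    with True cf show ?thesis by (simp add: Lp_ball_def)
  next
    case False
    define r where "r = enn2real p"
    have "(\<integral>\<^sup>+x. ennreal (norm (c *\<^sub>R f x) powr r) \<partial>M) =
        ennreal (\<bar>c\<bar> powr r) * (\<integral>\<^sup>+x. ennreal (norm (f x) powr r) \<partial>M)"
      by (simp add: nn_integral_cmult[symmetric] powr_mult ennreal_mult)
    also have "\<dots> \<le> ennreal (\<bar>c\<bar> powr r) * ennreal (C powr r)"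
      using f False by (intro mult_left_mono) (auto simp: Lp_ball_def r_def)
    also have "\<dots> = ennreal ((\<bar>c\<bar> * C) powr r)"
      using C by (simp add: ennreal_mult powr_mult)
    finally show ?thesis
      using False cf by (simp add: Lp_ball_def r_def)
  qed
qed

text \<open>Balls are closed under limits almost everywhere: Fatou's lemma for finite p, a countable
  union of null sets for infinite p.\<close>

lemma Lp_ball_LIMSEQ:
  assumes v: "\<And>n::nat. v n \<in> Lp_ball M p C" and lim: "AE x in M. (\<lambda>n. v n x) \<longlonglongrightarrow> f x"
    and p: "1 \<le> p"
  shows "f \<in> Lp_ball M p C"
proof -
  have v': "strongly_measurable M (v n)" for n
    using v[of n] by (simp add: Lp_ball_def)
  then have f: "strongly_measurable M f"
    using lim by (rule strongly_measurable_LIMSEQ)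
  note [measurable] = v'[THEN borel_measurable_norm]
  show ?thesis
  proof (cases "p = \<infinity>")
    case True
    have "AE x in M. \<forall>n. norm (v n x) \<le> C"
      using v True by (simp add: Lp_ball_def AE_all_countable)
    with lim have "AE x in M. norm (f x) \<le> C"
      by eventually_elim (rule LIMSEQ_le_const2[OF tendsto_norm], auto)
    with True f show ?thesis by (simp add: Lp_ball_def)
  next
    case False
    define r where "r = enn2real p"
    have r: "1 \<le> r" unfolding r_def by (rule enn2real_ge_1[OF p False])
    have "(\<integral>\<^sup>+x. ennreal (norm (f x) powr r) \<partial>M) \<le>
        (\<integral>\<^sup>+x. liminf (\<lambda>n. ennreal (norm (v n x) powr r)) \<partial>M)"
    proof (rule nn_integral_mono_AE)
      show "AE x in M. ennreal (norm (f x) powr r) \<le> liminf (\<lambda>n. ennreal (norm (v n x) powr r))"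
        using lim
      proof eventually_elim
        case (elim x)
        then have "(\<lambda>n. ennreal (norm (v n x) powr r)) \<longlonglongrightarrow> ennreal (norm (f x) powr r)"
          using r by (intro tendsto_ennrealI tendsto_powr' tendsto_norm tendsto_const) auto
        then show ?case
          using lim_imp_Liminf[OF sequentially_bot] by (metis order_refl)
      qed
    qed
    also have "\<dots> \<le> liminf (\<lambda>n. \<integral>\<^sup>+x. ennreal (norm (v n x) powr r) \<partial>M)"
      by (rule nn_integral_liminf) simp
    also have "\<dots> \<le> liminf (\<lambda>n. ennreal (C powr r))"
      using v False by (intro Liminf_mono always_eventually) (auto simp: Lp_ball_def r_def)
    also have "\<dots> = ennreal (C powr r)"
      by (simp add: Liminf_const)
    finally show ?thesis
      using False f by (simp add: Lp_ball_def r_def)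
  qed
qed

text \<open>For finite p the elementary bound "z to the s is at most 1 + z to the r", with z the
  norm of \<open>f x\<close> over \<open>C\<close>, replaces Hoelder's inequality. The resulting
  factor \<open>1 + measure M S\<close> is cruder than Hoelder's but depends only on the measure of
  \<open>S\<close>.\<close>

lemma Lp_ball_indicator_mono:
  assumes f: "f \<in> Lp_ball M p C" and C: "0 < C" and q: "1 \<le> q" "q \<le> p" "q \<noteq> \<infinity>"
    and S: "S \<in> sets M" "emeasure M S < \<infinity>"
  shows "(\<lambda>x. indicator S x *\<^sub>R f x) \<in> Lp_ball M q (C * (1 + measure M S))"
proof -
  have f': "strongly_measurable M f"
    using f by (simp add: Lp_ball_def)
  have Sf: "strongly_measurable M (\<lambda>x. indicator S x *\<^sub>R f x)"
    using S f' by (intro strongly_measurable_scaleR) auto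
  note [measurable] = f'[THEN borel_measurable_norm]
  define s where "s = enn2real q"
  have s: "1 \<le> s" unfolding s_def using q by (intro enn2real_ge_1) auto
  have S': "emeasure M S = ennreal (measure M S)"
    using S by (intro emeasure_eq_ennreal_measure) auto
  have powr_s: "z powr s = C powr s * (z / C) powr s" if "0 \<le> z" for z
    using C that by (simp add: powr_mult[symmetric])
  have "(\<integral>\<^sup>+x. ennreal (norm (indicator S x *\<^sub>R f x) powr s) \<partial>M) \<le> ennreal (C powr s * (1 + measure M S))"
  proof (cases "p = \<infinity>")
    case True
    then have "AE x in M. norm (f x) \<le> C"
      using f by (auto simp: Lp_ball_def)
    then have "AE x in M. ennreal (norm (indicator S x *\<^sub>R f x) powr s) \<le> ennreal (C powr s) * indicator S x"
    proof eventually_elim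
      case (elim x)
      then show ?case using s by (auto simp: indicator_def intro!: ennreal_leI powr_mono2)
    qed
    then have "(\<integral>\<^sup>+x. ennreal (norm (indicator S x *\<^sub>R f x) powr s) \<partial>M) \<le>
        (\<integral>\<^sup>+x. ennreal (C powr s) * indicator S x \<partial>M)"
      by (rule nn_integral_mono_AE)
    also have "\<dots> = ennreal (C powr s * measure M S)"
      using S by (simp add: nn_integral_cmult_indicator S' ennreal_mult)
    also have "\<dots> \<le> ennreal (C powr s * (1 + measure M S))"
      by (intro ennreal_leI mult_left_mono) auto
    finally show ?thesis .
  next
    case False
    define r where "r = enn2real p"
    have r: "s \<le> r"
      unfolding r_def s_def using q False by (intro enn2real_mono) (auto simp: less_top)
    have "(\<integral>\<^sup>+x. ennreal (norm (indicator S x *\<^sub>R f x) powr s) \<partial>M) \<le>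
        (\<integral>\<^sup>+x. ennreal (C powr s) * indicator S x +
          ennreal (C powr s * C powr (- r)) * ennreal (norm (f x) powr r) \<partial>M)"
    proof (intro nn_integral_mono)
      fix x
      have "norm (f x) powr s \<le> C powr s + C powr s * C powr (- r) * norm (f x) powr r"
      proof -
        have "(norm (f x) / C) powr s \<le> 1 + (norm (f x) / C) powr r"
        proof (cases "norm (f x) / C \<le> 1")
          case True
          then have "(norm (f x) / C) powr s \<le> 1 powr s"
            using C s by (intro powr_mono2) auto
          then show ?thesis by (simp add: add_increasing2)
        next
          case False
          then have "(norm (f x) / C) powr s \<le> (norm (f x) / C) powr r"
            using r by (intro powr_mono) auto
          then show ?thesis by simp
        qed
        then have "C powr s * (norm (f x) / C) powr s \<le> C powr s * (1 + (norm (f x) / C) powr r)"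
          by (intro mult_left_mono) auto
        moreover have "(norm (f x) / C) powr r = C powr (- r) * norm (f x) powr r"
          using C by (simp add: powr_divide powr_minus_divide)
        ultimately show ?thesis
          using powr_s[of "norm (f x)"] by (simp add: distrib_left mult.assoc)
      qed
      then show "ennreal (norm (indicator S x *\<^sub>R f x) powr s) \<le> ennreal (C powr s) * indicator S x +
          ennreal (C powr s * C powr (- r)) * ennreal (norm (f x) powr r)"
        by (auto simp: indicator_def ennreal_mult[symmetric] ennreal_plus[symmetric] ennreal_leI
            simp del: ennreal_plus)
    qed
    also have "\<dots> = ennreal (C powr s) * emeasure M S +
        ennreal (C powr s * C powr (- r)) * (\<integral>\<^sup>+x. ennreal (norm (f x) powr r) \<partial>M)"
      using S by (simp add: nn_integral_add nn_integral_cmult nn_integral_cmult_indicator)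
    also have "\<dots> \<le> ennreal (C powr s) * emeasure M S +
        ennreal (C powr s * C powr (- r)) * ennreal (C powr r)"
      using f False by (intro add_left_mono mult_left_mono) (auto simp: Lp_ball_def r_def)
    also have "\<dots> = ennreal (C powr s * (1 + measure M S))"
      using C by (simp add: S' ennreal_mult[symmetric] ennreal_plus[symmetric] distrib_left
          powr_minus mult.assoc add.commute del: ennreal_plus)
    finally show ?thesis .
  qed
  also have "\<dots> \<le> ennreal ((C * (1 + measure M S)) powr s)"
  proof (rule ennreal_leI)
    \<comment> \<open>The base is at least 1, so the factor may be raised to the power
      \<open>s\<close>; this spares the s-th root in the radius.\<close>
    have "(1 + measure M S) powr 1 \<le> (1 + measure M S) powr s"
      using s by (intro powr_mono) auto
    then show "C powr s * (1 + measure M S) \<le> (C * (1 + measure M S)) powr s"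
      using C by (simp add: powr_mult mult_left_mono)
  qed
  finally show ?thesis
    using Sf q by (simp add: Lp_ball_def s_def)
qed

end

section \<open>From balls on the line to L_p on the half-line\<close>

lemma Lp_ball_translation:
  fixes c :: real
  assumes "f \<in> Lp_ball lebesgue p C"
  shows "(\<lambda>x. f (c + x)) \<in> Lp_ball lebesgue p C"
proof -
  have f: "strongly_measurable lebesgue f"
    using assms by (simp add: Lp_ball_def)
  note [measurable] = completion.borel_measurable_norm[OF f]
  show ?thesis
    using assms AE_lebesgue_translation[of "\<lambda>x. norm (f x) \<le> C" c] strongly_measurable_translation[OF f, of c]
      nn_integral_real_affine_lebesgue[of "\<lambda>x. ennreal (norm (f x) powr enn2real p)" 1 c]
    by (auto simp: Lp_ball_def)
qed

lemma zero_in_Lp_ball: "0 \<le> C \<Longrightarrow> (\<lambda>_. 0) \<in> Lp_ball M p C"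
  by (auto simp: Lp_ball_def strongly_measurable_def intro!: exI[of _ "\<lambda>_ _. 0"])

text \<open>The bridge through which facts about \<open>Lp_space\<close> are read off from balls of
  zero extensions to the line. Membership is stated together with the bound because
  \<open>Lp_norm\<close> is real-valued and becomes 0 when the integral or the essential supremum is
  infinite.\<close>

lemma mem_Lp_space_iff:
  fixes u :: "real \<Rightarrow> 'u::real_normed_vector"
  assumes p: "1 \<le> p" and C: "0 \<le> C"
  shows "u \<in> Lp_space p \<and> Lp_norm p u \<le> C \<longleftrightarrow>
    (\<lambda>t. indicator {0..} t *\<^sub>R u t) \<in> Lp_ball lebesgue p C"
proof (cases "strongly_measurable (lebesgue_on {0..}) u")
  case False
  then show ?thesis
    by (simp add: Lp_space_def Lp_ball_def strongly_measurable_restrict_space)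
next
  case sm: True
  interpret complete_measure "lebesgue_on {0::real..}"
    by (rule complete_measure_lebesgue_on) simp
  note [measurable] = borel_measurable_norm[OF sm]
  have sm': "strongly_measurable lebesgue (\<lambda>t. indicator {0..} t *\<^sub>R u t)"
    using sm by (simp add: strongly_measurable_restrict_space)
  show ?thesis
  proof (cases "p = \<infinity>")
    case True
    let ?e = "esssup (lebesgue_on {0..}) (\<lambda>t. ennreal (norm (u t)))"
    have "?e < \<infinity> \<and> enn2real ?e \<le> C \<longleftrightarrow> ?e \<le> ennreal C"
      using C by (cases ?e rule: ennreal_cases) (auto simp: top_unique)
    also have "\<dots> \<longleftrightarrow> (AE t in lebesgue_on {0..}. norm (u t) \<le> C)"
    proof
      assume "?e \<le> ennreal C"
      then have "AE t in lebesgue_on {0..}. ennreal (norm (u t)) \<le> ennreal C"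
        using esssup_AE[of "\<lambda>t. ennreal (norm (u t))" "lebesgue_on {0..}"] by (auto intro: order_trans)
      then show "AE t in lebesgue_on {0..}. norm (u t) \<le> C"
        using C by simp
    next
      assume "AE t in lebesgue_on {0..}. norm (u t) \<le> C"
      then show "?e \<le> ennreal C"
        using C by (intro esssup_I) auto
    qed
    also have "\<dots> \<longleftrightarrow> (AE t in lebesgue. norm (indicator {0..} t *\<^sub>R u t) \<le> C)"
      using C by (subst AE_restrict_space_iff) (auto simp: indicator_def intro!: AE_cong)
    finally show ?thesis
      using True sm sm' by (simp add: Lp_space_def Lp_norm_def Lp_ball_def)
  next
    case False
    define r where "r = enn2real p"
    have r: "1 \<le> r" unfolding r_def by (rule enn2real_ge_1[OF p False])
    let ?I = "\<integral>\<^sup>+t. ennreal (norm (u t) powr r) \<partial>lebesgue_on {0..}"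
    have "(\<integral>\<^sup>+t. ennreal (norm (indicator {0..} t *\<^sub>R u t) powr r) \<partial>lebesgue) = ?I"
      by (subst nn_integral_restrict_space) (auto intro!: nn_integral_cong simp: indicator_def)
    moreover have "integrable (lebesgue_on {0..}) (\<lambda>t. norm (u t) powr r) \<longleftrightarrow> ?I < \<infinity>"
      by (simp add: integrable_iff_bounded)
    moreover have "(LINT t|lebesgue_on {0..}. norm (u t) powr r) = enn2real ?I"
      by (rule integral_eq_nn_integral) auto
    moreover have "enn2real ?I powr (1 / r) \<le> C \<longleftrightarrow> enn2real ?I \<le> C powr r"
    proof
      assume "enn2real ?I powr (1 / r) \<le> C"
      then have "(enn2real ?I powr (1 / r)) powr r \<le> C powr r"
        using r by (intro powr_mono2) auto
      then show "enn2real ?I \<le> C powr r" using r by (simp add: powr_powr)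
    next
      assume "enn2real ?I \<le> C powr r"
      then have "enn2real ?I powr (1 / r) \<le> (C powr r) powr (1 / r)"
        using r by (intro powr_mono2) auto
      then show "enn2real ?I powr (1 / r) \<le> C" using r C by (simp add: powr_powr)
    qed
    moreover have "?I < \<infinity> \<and> enn2real ?I \<le> C powr r \<longleftrightarrow> ?I \<le> ennreal (C powr r)"
      by (cases ?I rule: ennreal_cases) (auto simp: top_unique)
    ultimately show ?thesis
      using False sm sm' by (auto simp: Lp_space_def Lp_norm_def Lp_ball_def r_def)
  qed
qed

lemma Lp_norm_nonneg: "0 \<le> Lp_norm p u"
  by (simp add: Lp_norm_def)

lemma Lp_space_in_ball:
  assumes p: "1 \<le> p" and u: "u \<in> Lp_space p" and C: "Lp_norm p u \<le> C"
  shows "(\<lambda>t. indicator {0..} t *\<^sub>R u t) \<in> Lp_ball lebesgue p C"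
proof -
  have "0 \<le> C" using Lp_norm_nonneg[of p u] C by linarith
  with mem_Lp_space_iff[OF p this, of u] u C show ?thesis by blast
qed

lemma Lp_spaceI_ball:
  assumes p: "1 \<le> p" and C: "0 \<le> C"
    and ball: "\<And>e. 0 < e \<Longrightarrow> (\<lambda>t. indicator {0..} t *\<^sub>R u t) \<in> Lp_ball lebesgue p (C + e)"
  shows "u \<in> Lp_space p" and "Lp_norm p u \<le> C"
proof -
  have *: "u \<in> Lp_space p \<and> Lp_norm p u \<le> C + e" if "0 < e" for e
    using mem_Lp_space_iff[OF p, of "C + e" u] C that ball[OF that] by auto
  from *[of 1] show "u \<in> Lp_space p" by simp
  from * show "Lp_norm p u \<le> C" by (blast intro: field_le_epsilon)
qed

text \<open>Transfers an inclusion between balls to a norm estimate. The inclusion is demanded only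
  for positive radii, so the norm is approached from above, which also covers inputs of norm
  0.\<close>

lemma Lp_space_bounded_AE:
  assumes "1 \<le> p" "u \<in> Lp_space p" "1 \<le> q" "0 \<le> C"
    and "\<And>c. (\<lambda>t. indicator {0..} t *\<^sub>R u t) \<in> Lp_ball lebesgue p c \<Longrightarrow> 0 < c \<Longrightarrow>
      (\<lambda>t. indicator {0..} t *\<^sub>R v t) \<in> Lp_ball lebesgue q (C * c)"
  shows "v \<in> Lp_space q" and "Lp_norm q v \<le> C * Lp_norm p u"
proof -
  have ball: "(\<lambda>t. indicator {0..} t *\<^sub>R v t) \<in> Lp_ball lebesgue q (C * Lp_norm p u + e)" if "0 < e" for e
  proof -
    \<comment> \<open>Dividing by \<open>C + 1\<close> rather than \<open>C\<close> allows
      \<open>C = 0\<close> and still keeps the excess after multiplication by \<open>C\<close> at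
      most \<open>e\<close>.\<close>
    let ?c = "Lp_norm p u + e / (C + 1)"
    have c: "0 < ?c" "Lp_norm p u \<le> ?c"
      using that assms(4) Lp_norm_nonneg[of p u] by (auto intro: add_nonneg_pos)
    then have v: "(\<lambda>t. indicator {0..} t *\<^sub>R v t) \<in> Lp_ball lebesgue q (C * ?c)"
      by (intro assms Lp_space_in_ball c)
    have "C * (e / (C + 1)) \<le> e"
      using that assms(4) by (simp add: field_simps)
    then have "C * ?c \<le> C * Lp_norm p u + e"
      by (simp add: distrib_left)
    moreover have "0 \<le> C * ?c" using c assms(4) by simp
    ultimately show ?thesis
      using mem_Lp_space_iff[OF assms(3), of "C * ?c" v] v
      by (intro Lp_space_in_ball assms(3)) auto
  qed
  show "v \<in> Lp_space q" "Lp_norm q v \<le> C * Lp_norm p u"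
    using assms(4) Lp_norm_nonneg[of p u]
    by (auto intro!: Lp_spaceI_ball[where C = "C * Lp_norm p u"] ball assms(3))
qed

lemma Lp_space_add:
  assumes p: "1 \<le> p" and u: "u \<in> Lp_space p" and v: "v \<in> Lp_space p"
  shows "(\<lambda>t. u t + v t) \<in> Lp_space p" and "Lp_norm p (\<lambda>t. u t + v t) \<le> Lp_norm p u + Lp_norm p v"
proof -
  have ball: "(\<lambda>t. indicator {0..} t *\<^sub>R (u t + v t)) \<in> Lp_ball lebesgue p (Lp_norm p u + Lp_norm p v + e)"
    if "0 < e" for e
    using completion.Lp_ball_add[OF p _ _ Lp_space_in_ball[OF p u, of "Lp_norm p u + e / 2"]
        Lp_space_in_ball[OF p v, of "Lp_norm p v + e / 2"]]
      Lp_norm_nonneg[of p u] Lp_norm_nonneg[of p v] that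
    by (simp add: scaleR_add_right add_nonneg_pos algebra_simps)
  show "(\<lambda>t. u t + v t) \<in> Lp_space p" "Lp_norm p (\<lambda>t. u t + v t) \<le> Lp_norm p u + Lp_norm p v"
    using Lp_norm_nonneg[of p u] Lp_norm_nonneg[of p v]
    by (auto intro!: Lp_spaceI_ball[where C = "Lp_norm p u + Lp_norm p v"] p ball)
qed

lemma Lp_space_scaleR:
  assumes p: "1 \<le> p" and u: "u \<in> Lp_space p"
  shows "(\<lambda>t. c *\<^sub>R u t) \<in> Lp_space p" and "Lp_norm p (\<lambda>t. c *\<^sub>R u t) = \<bar>c\<bar> * Lp_norm p u"
proof -
  have *: "(\<lambda>t. c *\<^sub>R u t) \<in> Lp_space p \<and> Lp_norm p (\<lambda>t. c *\<^sub>R u t) \<le> \<bar>c\<bar> * Lp_norm p u"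
    if u: "u \<in> Lp_space p" for c and u :: "real \<Rightarrow> 'a"
  proof -
    have ball: "(\<lambda>t. indicator {0..} t *\<^sub>R (c *\<^sub>R u t)) \<in> Lp_ball lebesgue p (\<bar>c\<bar> * d)"
      if "(\<lambda>t. indicator {0..} t *\<^sub>R u t) \<in> Lp_ball lebesgue p d" "0 < d" for d
      using completion.Lp_ball_scaleR[OF that(1), of c] that(2) by (simp add: mult.commute)
    show ?thesis
      using Lp_space_bounded_AE[OF p u p abs_ge_zero ball] by blast
  qed
  show "(\<lambda>t. c *\<^sub>R u t) \<in> Lp_space p" using *[OF u] by blast
  show "Lp_norm p (\<lambda>t. c *\<^sub>R u t) = \<bar>c\<bar> * Lp_norm p u"
  proof (cases "c = 0")
    case True
    then show ?thesis using *[OF u, of c] Lp_norm_nonneg[of p "\<lambda>t. c *\<^sub>R u t"] by simp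
  next
    case False
    \<comment> \<open>The bound for the factor \<open>inverse c\<close>, applied to the scaled
      input, is the reverse inequality.\<close>
    have "Lp_norm p (\<lambda>t. inverse c *\<^sub>R (c *\<^sub>R u t)) \<le> \<bar>inverse c\<bar> * Lp_norm p (\<lambda>t. c *\<^sub>R u t)"
      using *[OF u, of c] * by blast
    then have "\<bar>c\<bar> * Lp_norm p u \<le> Lp_norm p (\<lambda>t. c *\<^sub>R u t)"
      using False by (simp add: field_simps)
    with *[OF u, of c] show ?thesis by auto
  qed
qed

lemma Lp_space_mono:
  assumes p: "1 \<le> p" and u: "u \<in> Lp_space p" and v: "strongly_measurable (lebesgue_on {0..}) v"
    and le: "AE t in lebesgue_on {0..}. norm (v t) \<le> norm (u t)"
  shows "v \<in> Lp_space p" and "Lp_norm p v \<le> Lp_norm p u"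
proof -
  have ball: "(\<lambda>t. indicator {0..} t *\<^sub>R v t) \<in> Lp_ball lebesgue p (1 * d)"
    if "(\<lambda>t. indicator {0..} t *\<^sub>R u t) \<in> Lp_ball lebesgue p d" "0 < d" for d
    using that v le
    by (auto intro!: completion.Lp_ball_mono_AE[OF that(1)]
        simp: strongly_measurable_restrict_space AE_restrict_space_iff indicator_def)
  show "v \<in> Lp_space p" "Lp_norm p v \<le> Lp_norm p u"
    using Lp_space_bounded_AE[OF p u p zero_le_one ball] by auto
qed

lemma Lp_space_indicator:
  fixes u :: "real \<Rightarrow> 'u::real_normed_vector"
  assumes p: "1 \<le> p" and u: "u \<in> Lp_space p" and S: "S \<in> sets lebesgue"
  shows "(\<lambda>t. indicator S t *\<^sub>R u t) \<in> Lp_space p" and "Lp_norm p (\<lambda>t. indicator S t *\<^sub>R u t) \<le> Lp_norm p u"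
proof -
  have "strongly_measurable (lebesgue_on {0..}) u"
    using u by (simp add: Lp_space_def)
  then have *: "strongly_measurable (lebesgue_on {0..}) (\<lambda>t. indicator S t *\<^sub>R u t)"
    using S by (intro strongly_measurable_scaleR measurable_restrict_space1 borel_measurable_indicator)
  show "(\<lambda>t. indicator S t *\<^sub>R u t) \<in> Lp_space p" "Lp_norm p (\<lambda>t. indicator S t *\<^sub>R u t) \<le> Lp_norm p u"
    by (rule Lp_space_mono[OF p u *], simp add: indicator_def)+
qed

lemma Lp_space_shift:
  assumes p: "1 \<le> p" and u: "u \<in> Lp_space p" and \<tau>: "0 \<le> \<tau>"
  shows "(\<lambda>t. u (\<tau> + t)) \<in> Lp_space p" and "Lp_norm p (\<lambda>t. u (\<tau> + t)) \<le> Lp_norm p u"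
proof -
  have ball: "(\<lambda>t. indicator {0..} t *\<^sub>R u (\<tau> + t)) \<in> Lp_ball lebesgue p (1 * d)"
    if "(\<lambda>t. indicator {0..} t *\<^sub>R u t) \<in> Lp_ball lebesgue p d" "0 < d" for d
  proof -
    have *: "(\<lambda>t. indicator {0..} (\<tau> + t) *\<^sub>R u (\<tau> + t)) \<in> Lp_ball lebesgue p d"
      using that(1) by (rule Lp_ball_translation)
    \<comment> \<open>The translated zero extension still lives on \<open>{-\<tau>..}\<close>; the
      part at negative arguments is cut off, which cannot increase the norm.\<close>
    have "strongly_measurable lebesgue (\<lambda>t. indicator {0..} t *\<^sub>R (indicator {0..} (\<tau> + t) *\<^sub>R u (\<tau> + t)))"
      using * by (intro strongly_measurable_scaleR[where f = "\<lambda>t. indicator {0..} (\<tau> + t) *\<^sub>R u (\<tau> + t)"])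
        (auto simp: Lp_ball_def intro!: borel_measurable_indicator)
    moreover have "(\<lambda>t. indicator {0..} t *\<^sub>R (indicator {0..} (\<tau> + t) *\<^sub>R u (\<tau> + t))) =
        (\<lambda>t. indicator {0..} t *\<^sub>R u (\<tau> + t))"
      using \<tau> by (auto simp: indicator_def)
    ultimately show ?thesis
      using \<tau> by (auto intro!: completion.Lp_ball_mono_AE[OF *] AE_I2 simp: indicator_def)
  qed
  show "(\<lambda>t. u (\<tau> + t)) \<in> Lp_space p" "Lp_norm p (\<lambda>t. u (\<tau> + t)) \<le> Lp_norm p u"
    using Lp_space_bounded_AE[OF p u p zero_le_one ball] by auto
qed

text \<open>Delaying with zero filling is what embeds a short time horizon into a longer one. The
  zero extension of the delayed input is exactly a translate, so nothing is cut off.\<close>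

lemma Lp_space_delay:
  assumes p: "1 \<le> p" and u: "u \<in> Lp_space p" and \<tau>: "0 \<le> \<tau>"
  shows "(\<lambda>t. indicator {\<tau>..} t *\<^sub>R u (t - \<tau>)) \<in> Lp_space p"
    and "Lp_norm p (\<lambda>t. indicator {\<tau>..} t *\<^sub>R u (t - \<tau>)) \<le> Lp_norm p u"
proof -
  have ball: "(\<lambda>t. indicator {0..} t *\<^sub>R (indicator {\<tau>..} t *\<^sub>R u (t - \<tau>))) \<in> Lp_ball lebesgue p (1 * d)"
    if "(\<lambda>t. indicator {0..} t *\<^sub>R u t) \<in> Lp_ball lebesgue p d" "0 < d" for d
  proof -
    have "(\<lambda>t. indicator {0..} (- \<tau> + t) *\<^sub>R u (- \<tau> + t)) \<in> Lp_ball lebesgue p d"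
      using that(1) by (rule Lp_ball_translation)
    moreover have "(\<lambda>t. indicator {0..} (- \<tau> + t) *\<^sub>R u (- \<tau> + t)) =
        (\<lambda>t. indicator {0..} t *\<^sub>R (indicator {\<tau>..} t *\<^sub>R u (t - \<tau>)))"
      using \<tau> by (auto simp: indicator_def)
    ultimately show ?thesis by simp
  qed
  show "(\<lambda>t. indicator {\<tau>..} t *\<^sub>R u (t - \<tau>)) \<in> Lp_space p"
    "Lp_norm p (\<lambda>t. indicator {\<tau>..} t *\<^sub>R u (t - \<tau>)) \<le> Lp_norm p u"
    using Lp_space_bounded_AE[OF p u p zero_le_one ball] by auto
qed

lemma Lp_space_cong:
  assumes p: "1 \<le> p" and u: "u \<in> Lp_space p" and eq: "\<And>t. 0 \<le> t \<Longrightarrow> v t = u t"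
  shows "v \<in> Lp_space p"
proof (rule Lp_space_mono(1)[OF p u])
  show "strongly_measurable (lebesgue_on {0..}) v"
    using u strongly_measurable_cong[of "lebesgue_on {0..}" v u] eq by (simp add: Lp_space_def)
qed (auto simp: eq)

lemma Lp_space_zero:
  assumes "1 \<le> p"
  shows "(\<lambda>_. 0) \<in> Lp_space p"
  using mem_Lp_space_iff[OF assms order_refl, of "\<lambda>_. 0"] zero_in_Lp_ball[of 0 lebesgue p]
    Lp_norm_nonneg[of p "\<lambda>_. 0"] by auto

lemma input_space_Lp:
  assumes p: "1 \<le> p"
  shows "input_space (Lp_space p :: (real \<Rightarrow> 'u::real_normed_vector) set) (Lp_norm p)"
proof
  fix u v :: "real \<Rightarrow> 'u"
  show "(\<lambda>_. 0) \<in> (Lp_space p :: (real \<Rightarrow> 'u) set)"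
    by (rule Lp_space_zero[OF p])
  assume u: "u \<in> Lp_space p"
  show "0 \<le> Lp_norm p u"
    by (rule Lp_norm_nonneg)
  show "(\<lambda>t. c *\<^sub>R u t) \<in> Lp_space p" "Lp_norm p (\<lambda>t. c *\<^sub>R u t) = \<bar>c\<bar> * Lp_norm p u" for c
    by (rule Lp_space_scaleR[OF p u])+
  show "(\<lambda>t. u (t + \<tau>)) \<in> Lp_space p" "Lp_norm p (\<lambda>t. u (t + \<tau>)) \<le> Lp_norm p u" if "0 \<le> \<tau>" for \<tau>
    using Lp_space_shift[OF p u that] by (simp_all add: add.commute)
  show "v \<in> Lp_space p \<and> Lp_norm p (\<lambda>t. u t - v t) = 0" if eq: "\<forall>t\<ge>0. v t = u t"
  proof
    show "v \<in> Lp_space p" using Lp_space_cong[OF p u] eq by blast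
    have "(\<lambda>t. indicator {0..} t *\<^sub>R (u t - v t)) = (\<lambda>_. 0)"
      using eq by (auto simp: indicator_def)
    then show "Lp_norm p (\<lambda>t. u t - v t) = 0"
      using mem_Lp_space_iff[OF p order_refl, of "\<lambda>t. u t - v t"] zero_in_Lp_ball[of 0 lebesgue p]
        Lp_norm_nonneg[of p "\<lambda>t. u t - v t"] by (auto intro: antisym)
  qed
  assume v: "v \<in> Lp_space p"
  show "(\<lambda>t. u t + v t) \<in> Lp_space p" "Lp_norm p (\<lambda>t. u t + v t) \<le> Lp_norm p u + Lp_norm p v"
    by (rule Lp_space_add[OF p u v])+
  show "concat_input t u v \<in> Lp_space p" if t: "0 < t" for t
  proof -
    \<comment> \<open>The delayed input already starts at \<open>s = t\<close>, a point that
      \<open>concat_input\<close> assigns to the first input; the extra indicator of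
      \<open>{t<..}\<close> removes it.\<close>
    have "(\<lambda>s. indicator {..t} s *\<^sub>R u s + indicator {t<..} s *\<^sub>R (indicator {t..} s *\<^sub>R v (s - t))) \<in> Lp_space p"
      using t by (intro Lp_space_add Lp_space_indicator Lp_space_delay p u v) auto
    moreover have "(\<lambda>s. indicator {..t} s *\<^sub>R u s + indicator {t<..} s *\<^sub>R (indicator {t..} s *\<^sub>R v (s - t))) =
        concat_input t u v"
      by (auto simp: concat_input_def indicator_def)
    ultimately show ?thesis by simp
  qed
qed

text \<open>The inclusion of L_p in L_q on a bounded interval; \<open>1 + t\<close> is the factor
  from \<open>Lp_ball_indicator_mono\<close> with \<open>t\<close> the length of the
  interval.\<close>

lemma Lp_space_local_mono:
  fixes u :: "real \<Rightarrow> 'u::real_normed_vector"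
  assumes p: "1 \<le> q" "q \<le> p" "q < \<infinity>" and u: "u \<in> Lp_space p" and t: "0 \<le> t"
  shows "(\<lambda>s. indicator {0..t} s *\<^sub>R u s) \<in> Lp_space q"
    and "Lp_norm q (\<lambda>s. indicator {0..t} s *\<^sub>R u s) \<le> (1 + t) * Lp_norm p u"
proof -
  have p1: "1 \<le> p" using p by auto
  have ball: "(\<lambda>s. indicator {0..} s *\<^sub>R (indicator {0..t} s *\<^sub>R u s)) \<in> Lp_ball lebesgue q ((1 + t) * d)"
    if "(\<lambda>t. indicator {0..} t *\<^sub>R u t) \<in> Lp_ball lebesgue p d" "0 < d" for d
    using completion.Lp_ball_indicator_mono[OF that p(1,2), of "{0..t}"] p(3) t
    by (simp add: scaleR_left_commute mult.commute)
  have "0 \<le> 1 + t" using t by simp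
  note * = Lp_space_bounded_AE[OF p1 u p(1) this ball]
  show "(\<lambda>s. indicator {0..t} s *\<^sub>R u s) \<in> Lp_space q"
    "Lp_norm q (\<lambda>s. indicator {0..t} s *\<^sub>R u s) \<le> (1 + t) * Lp_norm p u"
    by (rule *; assumption)+
qed

lemma nn_integral_local_le:
  fixes u :: "real \<Rightarrow> 'u::real_normed_vector"
  assumes p: "1 \<le> p" and u: "u \<in> Lp_space p" and t: "0 \<le> t"
  shows "(\<integral>\<^sup>+s. ennreal (norm (indicator {0..t} s *\<^sub>R u s)) \<partial>lebesgue) \<le> ennreal ((1 + t) * Lp_norm p u)"
proof -
  note loc = Lp_space_local_mono[OF order_refl p _ u t]
  have "(\<lambda>s. indicator {0..} s *\<^sub>R (indicator {0..t} s *\<^sub>R u s)) \<in> Lp_ball lebesgue 1 ((1 + t) * Lp_norm p u)"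
    using loc by (intro Lp_space_in_ball) auto
  also have "(\<lambda>s. indicator {0..} s *\<^sub>R (indicator {0..t} s *\<^sub>R u s)) = (\<lambda>s. indicator {0..t} s *\<^sub>R u s)"
    by (auto simp: indicator_def)
  finally show ?thesis
    using t Lp_norm_nonneg[of p u] by (simp add: Lp_ball_def)
qed

section \<open>Completeness of L_p and absolute continuity of the norm\<close>

lemma (in input_space) sum_in:
  "(\<And>k. k \<in> F \<Longrightarrow> w k \<in> \<U>) \<Longrightarrow> (\<lambda>t. \<Sum>k\<in>F. w k t) \<in> \<U>"
  by (induction F rule: infinite_finite_induct) (auto intro: zero_in add_in)

lemma (in input_space) norm_zero: "N (\<lambda>_. 0) = 0"
  using norm_scale[OF zero_in, of 0] by simp

lemma (in input_space) norm_sum_le: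
  "(\<And>k. k \<in> F \<Longrightarrow> w k \<in> \<U>) \<Longrightarrow> N (\<lambda>t. \<Sum>k\<in>F. w k t) \<le> (\<Sum>k\<in>F. N (w k))"
proof (induction F rule: infinite_finite_induct)
  case (insert k F)
  then have "N (\<lambda>t. w k t + (\<Sum>k\<in>F. w k t)) \<le> N (w k) + N (\<lambda>t. \<Sum>k\<in>F. w k t)"
    by (intro norm_triangle sum_in) auto
  with insert show ?case by (auto intro: order_trans)
qed (auto simp: norm_zero)

lemma (in input_space) diff_in:
  assumes "u \<in> \<U>" "v \<in> \<U>"
  shows "(\<lambda>t. u t - v t) \<in> \<U>"
  using add_in[OF assms(1) scale_in[OF assms(2), of "-1"]] by simp

text \<open>Riesz-Fischer for absolutely summable series. The L_1 norms on bounded intervals are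
  controlled by the L_p norms, so the series converges absolutely almost everywhere for every p at
  once; closedness of balls then bounds the tails.\<close>

theorem Lp_space_complete:
  fixes w :: "nat \<Rightarrow> real \<Rightarrow> 'u::banach"
  assumes p: "1 \<le> p" and w: "\<And>k. w k \<in> Lp_space p" and summable: "summable (\<lambda>k. Lp_norm p (w k))"
  shows "\<exists>f\<in>Lp_space p. \<forall>n. Lp_norm p (\<lambda>t. f t - (\<Sum>k<n. w k t)) \<le> (\<Sum>k. Lp_norm p (w (k + n)))"
proof -
  interpret input_space "Lp_space p :: (real \<Rightarrow> 'u) set" "Lp_norm p"
    by (rule input_space_Lp[OF p])
  have meas: "(\<lambda>s. ennreal (norm (indicator {0..t} s *\<^sub>R w k s))) \<in> borel_measurable lebesgue" for k and t :: real
  proof (cases "0 \<le> t")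
    case True
    have "strongly_measurable lebesgue (\<lambda>s. indicator {0..} s *\<^sub>R w k s)"
      using w by (simp add: Lp_space_def strongly_measurable_restrict_space)
    then have "strongly_measurable lebesgue (\<lambda>s. indicator {0..t} s *\<^sub>R (indicator {0..} s *\<^sub>R w k s))"
      by (rule strongly_measurable_scaleR) (simp add: borel_measurable_indicator)
    also have "(\<lambda>s. indicator {0..t} s *\<^sub>R (indicator {0..} s *\<^sub>R w k s)) = (\<lambda>s. indicator {0..t} s *\<^sub>R w k s)"
      by (auto simp: indicator_def)
    finally show ?thesis
      by (intro measurable_compose[OF completion.borel_measurable_norm measurable_ennreal])
  qed simp
  \<comment> \<open>Integer endpoints exhaust the half-line at the price of countably many null
    sets.\<close>
  have "AE s in lebesgue. (\<Sum>k. ennreal (norm (indicator {0..real m} s *\<^sub>R w k s))) \<noteq> \<infinity>" for m :: nat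
  proof (rule nn_integral_PInf_AE)
    show "(\<lambda>s. \<Sum>k. ennreal (norm (indicator {0..real m} s *\<^sub>R w k s))) \<in> borel_measurable lebesgue"
      by (intro borel_measurable_suminf_order meas)
    have "(\<integral>\<^sup>+s. (\<Sum>k. ennreal (norm (indicator {0..real m} s *\<^sub>R w k s))) \<partial>lebesgue) =
        (\<Sum>k. \<integral>\<^sup>+s. ennreal (norm (indicator {0..real m} s *\<^sub>R w k s)) \<partial>lebesgue)"
      by (intro nn_integral_suminf meas)
    also have "\<dots> \<le> (\<Sum>k. ennreal ((1 + real m) * Lp_norm p (w k)))"
      by (intro suminf_le nn_integral_local_le p w) auto
    also have "\<dots> = ennreal (\<Sum>k. (1 + real m) * Lp_norm p (w k))"
      using summable by (intro suminf_ennreal2 summable_mult) (auto intro!: mult_nonneg_nonneg Lp_norm_nonneg)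
    finally show "(\<integral>\<^sup>+s. (\<Sum>k. ennreal (norm (indicator {0..real m} s *\<^sub>R w k s))) \<partial>lebesgue) \<noteq> \<infinity>"
      by (auto simp: top_unique)
  qed
  then have "AE s in lebesgue. \<forall>m. (\<Sum>k. ennreal (norm (indicator {0..real m} s *\<^sub>R w k s))) \<noteq> \<infinity>"
    by (simp add: AE_all_countable)
  then have conv: "AE s in lebesgue. 0 \<le> s \<longrightarrow> summable (\<lambda>k. w k s)"
  proof eventually_elim
    case (elim s)
    show ?case
    proof
      assume s: "0 \<le> s"
      obtain m where "s \<le> real m" using real_arch_simple by blast
      with s elim[rule_format, of m] have "(\<Sum>k. ennreal (norm (w k s))) \<noteq> \<infinity>"
        by simp
      then have "summable (\<lambda>k. norm (w k s))"
        by (intro summable_suminf_not_top) auto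
      then show "summable (\<lambda>k. w k s)" by (rule summable_norm_cancel)
    qed
  qed
  define f where "f s = (\<Sum>k. w k s)" for s
  have tail: "(\<lambda>t. f t - (\<Sum>k<n. w k t)) \<in> Lp_space p \<and>
      Lp_norm p (\<lambda>t. f t - (\<Sum>k<n. w k t)) \<le> (\<Sum>k. Lp_norm p (w (k + n)))" for n
  proof (subst mem_Lp_space_iff[OF p])
    have summable_n: "summable (\<lambda>k. Lp_norm p (w (k + n)))"
      using summable by (rule summable_ignore_initial_segment)
    show "0 \<le> (\<Sum>k. Lp_norm p (w (k + n)))"
      by (intro suminf_nonneg summable_n Lp_norm_nonneg)
    show "(\<lambda>t. indicator {0..} t *\<^sub>R (f t - (\<Sum>k<n. w k t))) \<in> Lp_ball lebesgue p (\<Sum>k. Lp_norm p (w (k + n)))"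
    proof (rule completion.Lp_ball_LIMSEQ[OF _ _ p])
      show "(\<lambda>t. indicator {0..} t *\<^sub>R (\<Sum>k<m. w (k + n) t)) \<in> Lp_ball lebesgue p (\<Sum>k. Lp_norm p (w (k + n)))" for m
      proof (rule Lp_space_in_ball[OF p sum_in])
        have "Lp_norm p (\<lambda>t. \<Sum>k<m. w (k + n) t) \<le> (\<Sum>k<m. Lp_norm p (w (k + n)))"
          by (rule norm_sum_le[OF w])
        also have "\<dots> \<le> (\<Sum>k. Lp_norm p (w (k + n)))"
          by (intro sum_le_suminf summable_n) (auto intro: Lp_norm_nonneg)
        finally show "Lp_norm p (\<lambda>t. \<Sum>k<m. w (k + n) t) \<le> (\<Sum>k. Lp_norm p (w (k + n)))" .
      qed (rule w)
      show "AE t in lebesgue. (\<lambda>m. indicator {0..} t *\<^sub>R (\<Sum>k<m. w (k + n) t)) \<longlonglongrightarrow>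
          indicator {0..} t *\<^sub>R (f t - (\<Sum>k<n. w k t))"
        using conv
      proof eventually_elim
        case (elim t)
        show ?case
        proof (cases "0 \<le> t")
          case True
          with elim have "summable (\<lambda>k. w k t)" by simp
          then have "(\<lambda>k. w (k + n) t) sums (f t - (\<Sum>k<n. w k t))"
            unfolding f_def by (intro sums_split_initial_segment summable_sums)
          with True show ?thesis by (simp add: sums_def)
        qed simp
      qed
    qed
  qed
  from tail[of 0] have "f \<in> Lp_space p" by simp
  with tail show ?thesis by blast
qed

text \<open>Dominated convergence: the integrand, cut down to the intervals, tends to zero except at
  the null set consisting of \<open>t\<close>. For infinite q a nonzero constant input would be a
  counterexample at any nonnegative \<open>t\<close>.\<close>

lemma Lp_norm_shrinking_interval:
  fixes w :: "real \<Rightarrow> 'u::real_normed_vector"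
  assumes q: "1 \<le> q" "q < \<infinity>" and w: "w \<in> Lp_space q"
  shows "(\<lambda>n. Lp_norm q (\<lambda>s. indicator {t - 1 / Suc n..t + 1 / Suc n} s *\<^sub>R w s)) \<longlonglongrightarrow> 0"
proof -
  define r where "r = enn2real q"
  have q': "q \<noteq> \<infinity>" using q by auto
  have r: "1 \<le> r" unfolding r_def by (rule enn2real_ge_1[OF q(1) q'])
  let ?I = "\<lambda>n. {t - 1 / Suc n..t + 1 / Suc n}"
  let ?w = "\<lambda>s. indicator {0..} s *\<^sub>R w s"
  have ball: "?w \<in> Lp_ball lebesgue q (Lp_norm q w)"
    by (rule Lp_space_in_ball[OF q(1) w order_refl])
  then have "strongly_measurable lebesgue ?w" by (simp add: Lp_ball_def)
  then have [measurable]: "(\<lambda>s. norm (?w s)) \<in> borel_measurable lebesgue"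
    by (rule completion.borel_measurable_norm)
  have meas_powr: "(\<lambda>s. ennreal (norm (?w s) powr r)) \<in> borel_measurable lebesgue"
    by measurable
  have lim: "(\<lambda>n. \<integral>\<^sup>+s. ennreal (norm (?w s) powr r) * indicator (?I n) s \<partial>lebesgue) \<longlonglongrightarrow> (\<integral>\<^sup>+(s::real). 0 \<partial>lebesgue)"
  proof (rule nn_integral_dominated_convergence[where w = "\<lambda>s. ennreal (norm (?w s) powr r)" and u' = "\<lambda>_. 0"])
    show "AE s in lebesgue. ennreal (norm (?w s) powr r) * indicator (?I n) s \<le> ennreal (norm (?w s) powr r)" for n
      by (auto simp: indicator_def)
    have "(\<integral>\<^sup>+s. ennreal (norm (?w s) powr r) \<partial>lebesgue) \<le> ennreal (Lp_norm q w powr r)"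
      using ball q' by (simp add: Lp_ball_def r_def)
    also have "\<dots> < \<infinity>" by simp
    finally show "(\<integral>\<^sup>+s. ennreal (norm (?w s) powr r) \<partial>lebesgue) < \<infinity>" .
    show "AE s in lebesgue. (\<lambda>n. ennreal (norm (?w s) powr r) * indicator (?I n) s) \<longlonglongrightarrow> 0"
      using AE_lebesgue_singleton[of t]
    proof eventually_elim
      case (elim s)
      then have "\<forall>\<^sub>F n in sequentially. 1 / real (Suc n) < \<bar>s - t\<bar>"
        using LIMSEQ_inverse_real_of_nat by (intro order_tendstoD(2)) (auto simp: inverse_eq_divide)
      then have "\<forall>\<^sub>F n in sequentially. ennreal (norm (?w s) powr r) * indicator (?I n) s = 0"
        by eventually_elim (auto simp: indicator_def)
      then show ?case by (rule tendsto_eventually)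
    qed
    show "(\<lambda>s. ennreal (norm (?w s) powr r) * indicator (?I n) s) \<in> borel_measurable lebesgue" for n
      by (rule borel_measurable_times_ennreal[OF meas_powr borel_measurable_indicator]) simp
  qed (simp, rule meas_powr)
  have eq: "(\<integral>\<^sup>+s. ennreal (norm (indicator {0..} s *\<^sub>R (indicator (?I n) s *\<^sub>R w s)) powr r) \<partial>lebesgue) =
      (\<integral>\<^sup>+s. ennreal (norm (?w s) powr r) * indicator (?I n) s \<partial>lebesgue)" for n
    by (intro nn_integral_cong) (auto simp: indicator_def)
  show ?thesis
  proof (rule LIMSEQ_I)
    fix e :: real assume e: "0 < e"
    then have "\<forall>\<^sub>F n in sequentially. (\<integral>\<^sup>+s. ennreal (norm (?w s) powr r) * indicator (?I n) s \<partial>lebesgue) < ennreal ((e / 2) powr r)"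
      using lim by (intro order_tendstoD(2)) auto
    then obtain n0 where n0: "\<And>n. n0 \<le> n \<Longrightarrow>
        (\<integral>\<^sup>+s. ennreal (norm (?w s) powr r) * indicator (?I n) s \<partial>lebesgue) < ennreal ((e / 2) powr r)"
      by (auto simp: eventually_sequentially)
    have "norm (Lp_norm q (\<lambda>s. indicator (?I n) s *\<^sub>R w s) - 0) < e" if n: "n0 \<le> n" for n
    proof -
      have "(\<lambda>s. indicator (?I n) s *\<^sub>R w s) \<in> Lp_space q"
        by (intro Lp_space_indicator q w) auto
      then have "strongly_measurable lebesgue (\<lambda>s. indicator {0..} s *\<^sub>R (indicator (?I n) s *\<^sub>R w s))"
        by (simp add: Lp_space_def strongly_measurable_restrict_space)
      then have "(\<lambda>s. indicator {0..} s *\<^sub>R (indicator (?I n) s *\<^sub>R w s)) \<in> Lp_ball lebesgue q (e / 2)"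
        using n0[OF n] q' unfolding eq[symmetric] by (simp add: Lp_ball_def r_def)
      then have "Lp_norm q (\<lambda>s. indicator (?I n) s *\<^sub>R w s) \<le> e / 2"
        using mem_Lp_space_iff[OF q(1), of "e / 2" "\<lambda>s. indicator (?I n) s *\<^sub>R w s"] e by simp
      then show ?thesis
        using e Lp_norm_nonneg[of q "\<lambda>s. indicator (?I n) s *\<^sub>R w s"] by simp
    qed
    then show "\<exists>n0. \<forall>n\<ge>n0. norm (Lp_norm q (\<lambda>s. indicator (?I n) s *\<^sub>R w s) - 0) < e" by blast
  qed
qed

section \<open>Uniform boundedness\<close>

text \<open>Sokal's gliding hump argument. Replacing a partial sum \<open>y\<close> by one of \<open>y + v\<close>, \<open>y - v\<close> does
  not decrease a seminorm below its value at \<open>v\<close>, so no cancellation can occur.\<close>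

theorem (in input_space) uniform_boundedness:
  fixes P :: "'i \<Rightarrow> (real \<Rightarrow> 'u) \<Rightarrow> real"
  assumes complete: "\<And>w :: nat \<Rightarrow> real \<Rightarrow> 'u. (\<And>k. w k \<in> \<U>) \<Longrightarrow> summable (\<lambda>k. N (w k)) \<Longrightarrow>
      \<exists>f\<in>\<U>. \<forall>n. N (\<lambda>t. f t - (\<Sum>k<n. w k t)) \<le> (\<Sum>k. N (w (k + n)))"
    and P_add: "\<And>i u v. u \<in> \<U> \<Longrightarrow> v \<in> \<U> \<Longrightarrow> P i (\<lambda>t. u t + v t) \<le> P i u + P i v"
    and P_scale: "\<And>i c u. u \<in> \<U> \<Longrightarrow> P i (\<lambda>t. c *\<^sub>R u t) = \<bar>c\<bar> * P i u"
    and P_le: "\<And>i. \<exists>c. \<forall>u\<in>\<U>. P i u \<le> c * N u"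
    and P_bdd: "\<And>u. u \<in> \<U> \<Longrightarrow> bdd_above (range (\<lambda>i. P i u))"
  shows "\<exists>C. \<forall>i. \<forall>u\<in>\<U>. P i u \<le> C * N u"
proof -
  define op where "op i = (SUP u\<in>{u \<in> \<U>. N u \<le> 1}. P i u)" for i
  have zero_ball: "(\<lambda>_. 0) \<in> {u \<in> \<U>. N u \<le> 1}"
    by (simp add: zero_in norm_zero)
  have op_bdd: "bdd_above (P i ` {u \<in> \<U>. N u \<le> 1})" for i
  proof -
    obtain c where c: "\<And>u. u \<in> \<U> \<Longrightarrow> P i u \<le> c * N u" using P_le by blast
    have "P i u \<le> \<bar>c\<bar>" if "u \<in> \<U>" "N u \<le> 1" for u
    proof -
      have "c * N u \<le> \<bar>c\<bar> * N u" by (intro mult_right_mono norm_nonneg that) simp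
      also have "\<dots> \<le> \<bar>c\<bar>" using mult_left_mono[OF that(2), of "\<bar>c\<bar>"] by simp
      finally show ?thesis using c[OF that(1)] by linarith
    qed
    then show ?thesis by (intro bdd_aboveI2) auto
  qed
  have le_op: "P i u \<le> op i * N u" if u: "u \<in> \<U>" for i u
  proof (cases "N u = 0")
    \<comment> \<open>\<open>N\<close> is only a seminorm, so this does not mean that
      \<open>u\<close> is zero; the individual bound \<open>P_le\<close> still forces
      \<open>P i u \<le> 0\<close>.\<close>
    case True
    then show ?thesis using P_le[of i] u by auto
  next
    case False
    with norm_nonneg[OF u] have pos: "0 < N u" by simp
    then have "(\<lambda>t. (1 / N u) *\<^sub>R u t) \<in> {u \<in> \<U>. N u \<le> 1}"
      using scale_in[OF u] norm_scale[OF u, of "1 / N u"] by simp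
    then have "P i (\<lambda>t. (1 / N u) *\<^sub>R u t) \<le> op i"
      unfolding op_def by (intro cSUP_upper op_bdd)
    with pos show ?thesis
      using P_scale[OF u, of i "1 / N u"] by (simp add: field_simps)
  qed
  have "bdd_above (range op)"
  proof (rule ccontr)
    assume "\<not> bdd_above (range op)"
    \<comment> \<open>The growth rate 4 is chosen to outrun the scaling \<open>(1 / 3) ^ k\<close>
      of the humps.\<close>
    then have "\<exists>i. 4 ^ k < op i" for k :: nat
      unfolding bdd_above_def by (force simp: not_le)
    then obtain i where i: "\<And>k::nat. 4 ^ k < op (i k)" by metis
    \<comment> \<open>The fraction 3/4 has to exceed 1/2, the share of \<open>op (i k)\<close> that
      the later humps can cancel in units of \<open>(1 / 3) ^ k\<close>.\<close>
    have "\<exists>v\<in>{u \<in> \<U>. N u \<le> 1}. 3 / 4 * op (i k) < P (i k) v" for k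
    proof -
      have "0 < op (i k)"
        using i[of k] zero_less_power[of "4::real" k] by linarith
      then have "3 / 4 * op (i k) < op (i k)" by simp
      then show ?thesis
        unfolding op_def[of "i k"] using zero_ball op_bdd by (subst (asm) less_cSUP_iff) auto
    qed
    then obtain v where v: "\<And>k. v k \<in> \<U>" "\<And>k. N (v k) \<le> 1" "\<And>k. 3 / 4 * op (i k) < P (i k) (v k)"
      by (metis (no_types, lifting) mem_Collect_eq)
    define h where "h k = (\<lambda>t. (1 / 3) ^ k *\<^sub>R v k t)" for k :: nat
    have h: "h k \<in> \<U>" "N (h k) \<le> (1 / 3) ^ k" "P (i k) (h k) \<ge> (1 / 3) ^ k * (3 / 4 * op (i k))" for k
      using scale_in[OF v(1)[of k], of "(1 / 3) ^ k"] norm_scale[OF v(1)[of k], of "(1 / 3) ^ k"]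
        P_scale[OF v(1)[of k], of "i k" "(1 / 3) ^ k"] v(2,3)[of k]
      by (auto simp: h_def abs_mult mult_left_mono mult_left_le)
    define step where "step k y = (if P (i k) (h k) \<le> P (i k) (\<lambda>t. y t + h k t) then h k else (\<lambda>t. - h k t))"
      for k and y :: "real \<Rightarrow> 'u"
    define x where "x = rec_nat (\<lambda>_. 0) (\<lambda>k y t. y t + step k y t)"
    define w where "w k = step k (x k)" for k
    have x_Suc: "x (Suc k) = (\<lambda>t. x k t + w k t)" for k
      by (simp add: x_def w_def)
    have minus_h: "(\<lambda>t. - h k t) \<in> \<U>" "N (\<lambda>t. - h k t) = N (h k)" for k
      using scale_in[OF h(1)[of k], of "-1"] norm_scale[OF h(1)[of k], of "-1"] by auto
    have w: "w k \<in> \<U>" "N (w k) \<le> (1 / 3) ^ k" for k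
      using h(1,2)[of k] minus_h[of k] by (auto simp: w_def step_def)
    have x_eq: "x k = (\<lambda>t. \<Sum>j<k. w j t)" for k
      by (induction k) (auto simp: x_Suc, auto simp: x_def)
    then have x: "x k \<in> \<U>" for k
      using sum_in[of "{..<k}" w] w by simp
    have hump: "P (i k) (h k) \<le> P (i k) (x (Suc k))" for k
    proof (cases "P (i k) (h k) \<le> P (i k) (\<lambda>t. x k t + h k t)")
      case True
      then show ?thesis by (simp add: x_Suc w_def step_def)
    next
      case False
      let ?y = "\<lambda>t. x k t + - h k t"
      have y: "?y \<in> \<U>" by (intro add_in x minus_h)
      have "2 * P (i k) (h k) = P (i k) (\<lambda>t. 2 *\<^sub>R h k t)"
        using P_scale[OF h(1), of "i k" 2 k] by simp
      \<comment> \<open>Twice the hump is the difference of the two candidates for the next partial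
        sum, so they cannot both have a seminorm below that of the hump.\<close>
      also have "(\<lambda>t. 2 *\<^sub>R h k t) = (\<lambda>t. (x k t + h k t) + (-1) *\<^sub>R ?y t)"
        by (simp add: scaleR_2)
      also have "P (i k) \<dots> \<le> P (i k) (\<lambda>t. x k t + h k t) + P (i k) (\<lambda>t. (-1) *\<^sub>R ?y t)"
        by (intro P_add add_in x h scale_in[OF y])
      also have "P (i k) (\<lambda>t. (-1) *\<^sub>R ?y t) = P (i k) ?y"
        using P_scale[OF y, of "i k" "-1"] by simp
      finally show ?thesis using False by (simp add: x_Suc w_def step_def)
    qed
    have geometric: "summable (\<lambda>k. (1 / 3 :: real) ^ k)" by (rule summable_geometric) simp
    have sum_N: "summable (\<lambda>k. N (w k))"
      by (rule summable_comparison_test'[OF geometric]) (use w norm_nonneg in auto)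
    then obtain f where f: "f \<in> \<U>"
      and f_tail: "\<And>n. N (\<lambda>t. f t - (\<Sum>k<n. w k t)) \<le> (\<Sum>k. N (w (k + n)))"
      using complete[of w, OF w(1)] by blast
    obtain C where C: "\<And>i. P i f \<le> C"
      using P_bdd[OF f] by (auto simp: bdd_above_def)
    have "(4 / 3) ^ k \<le> 4 * C" for k
    proof -
      \<comment> \<open>With ratio 1/3, everything after hump \<open>k\<close> adds up to at most
        half of \<open>(1 / 3) ^ k\<close>.\<close>
      have "(\<Sum>m. N (w (m + Suc k))) \<le> (\<Sum>m. (1 / 3) ^ Suc k * (1 / 3) ^ m)"
      proof (rule suminf_le)
        show "summable (\<lambda>m. N (w (m + Suc k)))"
          using sum_N by (subst summable_iff_shift)
        show "summable (\<lambda>m. (1 / 3 :: real) ^ Suc k * (1 / 3) ^ m)"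
          using geometric by (rule summable_mult)
        show "N (w (m + Suc k)) \<le> (1 / 3) ^ Suc k * (1 / 3) ^ m" for m
          using w(2)[of "m + Suc k"] by (simp add: power_add mult_ac)
      qed
      also have "\<dots> = (1 / 3) ^ k / 2"
        using suminf_mult[OF geometric, of "(1 / 3) ^ Suc k"] suminf_geometric[of "1 / 3 :: real"] by simp
      finally have Nd: "N (\<lambda>t. f t - x (Suc k) t) \<le> (1 / 3) ^ k / 2"
        using f_tail[of "Suc k"] unfolding x_eq by linarith
      have d: "(\<lambda>t. f t - x (Suc k) t) \<in> \<U>"
        by (intro diff_in f x)
      have pos: "0 < op (i k)"
        using i[of k] zero_less_power[of "4::real" k] by linarith
      have Pd: "P (i k) (\<lambda>t. f t - x (Suc k) t) \<le> op (i k) * ((1 / 3) ^ k / 2)"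
        using le_op[OF d, of "i k"] mult_left_mono[OF Nd less_imp_le[OF pos]] by (rule order_trans)
      have nd: "P (i k) (\<lambda>t. (-1) *\<^sub>R (f t - x (Suc k) t)) = P (i k) (\<lambda>t. f t - x (Suc k) t)"
        using P_scale[OF d, of "i k" "-1"] by simp
      have "P (i k) (\<lambda>t. f t + (-1) *\<^sub>R (f t - x (Suc k) t)) \<le> P (i k) f + P (i k) (\<lambda>t. (-1) *\<^sub>R (f t - x (Suc k) t))"
        by (intro P_add f scale_in[OF d])
      then have "P (i k) (x (Suc k)) \<le> C + op (i k) * ((1 / 3) ^ k / 2)"
        using Pd C[of "i k"] unfolding nd by simp
      \<comment> \<open>With \<open>X\<close> the left-hand side, the hump contributes at least
        \<open>3 / 4 * X\<close> and the tail removes at most \<open>X / 2\<close>, so a quarter of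
        \<open>X\<close> survives below \<open>C\<close>.\<close>
      then have "(1 / 3) ^ k * op (i k) \<le> 4 * C"
      proof -
        define X where "X = (1 / 3) ^ k * op (i k)"
        have "op (i k) * ((1 / 3) ^ k / 2) = X / 2" "(1 / 3) ^ k * (3 / 4 * op (i k)) = 3 / 4 * X"
          by (simp_all add: X_def)
        with \<open>P (i k) (x (Suc k)) \<le> C + op (i k) * ((1 / 3) ^ k / 2)\<close> hump[of k] h(3)[of k]
        have "X \<le> 4 * C" by linarith
        then show ?thesis by (simp only: X_def)
      qed
      moreover have "(1 / 3) ^ k * 4 ^ k \<le> (1 / 3) ^ k * op (i k)"
        using i[of k] by (intro mult_left_mono) auto
      ultimately show ?thesis by (simp add: power_mult_distrib[symmetric])
    qed
    moreover obtain k where "4 * C < (4 / 3) ^ k"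
      using real_arch_pow[of "4 / 3" "4 * C"] by auto
    ultimately show False by (meson not_less)
  qed
  then obtain C where C: "\<And>i. op i \<le> C" by (auto simp: bdd_above_def)
  have "P i u \<le> C * N u" if "u \<in> \<U>" for i u
    using le_op[OF that, of i] mult_right_mono[OF C[of i] norm_nonneg[OF that]] by linarith
  then show ?thesis by blast
qed

section \<open>Admissible input operators for exponentially stable semigroups\<close>

text \<open>Decay is recorded in X, where the final estimate lives; for \<open>T1\<close> a uniform
  bound is enough, as it is used only to estimate integrals over bounded intervals. \<open>V\<close>
  mediates between the two norms.\<close>

locale stable_input_system =
  fixes T :: "real \<Rightarrow> 'x::banach \<Rightarrow>\<^sub>L 'x" and j :: "'x \<Rightarrow> 'e::banach"
    and T1 :: "real \<Rightarrow> 'e \<Rightarrow>\<^sub>L 'e" and B :: "'u::banach \<Rightarrow>\<^sub>L 'e"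
    and q :: ennreal and M \<omega> :: real and V :: "nat \<Rightarrow> 'x \<Rightarrow> 'x"
  assumes C0: "C0_semigroup T"
    and T_bound: "\<And>t. 0 \<le> t \<Longrightarrow> norm (T t) \<le> M * exp (- \<omega> * t)" and M: "1 \<le> M" and \<omega>: "0 < \<omega>"
    and j_linear: "linear j" and j_inj: "inj j"
    and T1_add: "\<And>s t. 0 \<le> s \<Longrightarrow> 0 \<le> t \<Longrightarrow> T1 (s + t) = T1 s o\<^sub>L T1 t"
    and T1_extends: "\<And>t x. 0 \<le> t \<Longrightarrow> T1 t (j x) = j (T t x)"
    and T1_bound: "\<And>t. 0 \<le> t \<Longrightarrow> norm (T1 t) \<le> M"
    and V_linear: "\<And>n. linear (V n)" and V_bound: "\<And>n. \<exists>c. \<forall>x. norm (V n x) \<le> c * norm (j x)"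
    and V_lim: "\<And>x. (\<lambda>n. V n x) \<longlonglongrightarrow> x"
    and q: "1 \<le> q" "q < \<infinity>" and admissible: "admissible j T1 B q"
begin

section \<open>Algebra and existence of the input integral\<close>

abbreviation "integral_in t u y \<equiv> input_integral j T1 B t u y"

definition \<Phi> :: "real \<Rightarrow> (real \<Rightarrow> 'u) \<Rightarrow> 'x" where
  "\<Phi> t u = (THE y. integral_in t u y)"

text \<open>Extension by zero to the whole line turns delays and shifts of the input into plain
  translations of the integrand.\<close>

definition integrand :: "real \<Rightarrow> (real \<Rightarrow> 'u) \<Rightarrow> real \<Rightarrow> 'e" where
  "integrand t u r = indicator {0..t} r *\<^sub>R T1 (t - r) (B (u r))"

lemma integral_in_iff: "integral_in t u y \<longleftrightarrow> has_vec_integral lebesgue (integrand t u) (j y)"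
  unfolding input_integral_def integrand_def[abs_def] by (rule has_vec_integral_restrict_space) simp

lemma integral_in_unique: "integral_in t u y \<Longrightarrow> integral_in t u z \<Longrightarrow> y = z"
  unfolding integral_in_iff using has_vec_integral_unique j_inj by (metis injD)

lemma \<Phi>_eq: "integral_in t u y \<Longrightarrow> \<Phi> t u = y"
  unfolding \<Phi>_def using integral_in_unique by blast

lemma integral_in_cong:
  assumes "\<And>s. 0 \<le> s \<Longrightarrow> s \<le> t \<Longrightarrow> u s = v s"
  shows "integral_in t u y \<longleftrightarrow> integral_in t v y"
  unfolding input_integral_def using assms by (intro has_vec_integral_cong) auto

text \<open>Substituting \<open>r + (t - s)\<close> for \<open>r\<close> leaves \<open>s - r\<close>
  as the time of the semigroup, while the delayed input vanishes before \<open>t - s\<close>. Hence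
  integrals at one time determine those at all earlier times.\<close>

lemma integral_in_delay:
  assumes st: "s \<le> t" and y: "integral_in t (\<lambda>r. indicator {t - s..} r *\<^sub>R u (r - (t - s))) y"
  shows "integral_in s u y"
proof -
  have "integrand s u = (\<lambda>r. integrand t (\<lambda>r. indicator {t - s..} r *\<^sub>R u (r - (t - s))) ((t - s) + r))"
    using st by (auto simp: integrand_def indicator_def)
  then show ?thesis
    using y unfolding integral_in_iff by (simp add: has_vec_integral_translation)
qed

lemma integral_in_add:
  assumes t: "0 \<le> t" and h: "0 \<le> h" and y: "integral_in t u y" and z: "integral_in h (\<lambda>s. u (t + s)) z"
  shows "integral_in (t + h) u (T h y + z)"
proof -
  let ?f = "\<lambda>r. T1 h (integrand t u r)" and ?g = "\<lambda>r. integrand h (\<lambda>s. u (t + s)) (- t + r)"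
  have f: "has_vec_integral lebesgue ?f (T1 h (j y))"
    using y unfolding integral_in_iff by (rule has_vec_integral_bounded_linear[OF blinfun.bounded_linear_right])
  have g: "has_vec_integral lebesgue ?g (j z)"
    using z unfolding integral_in_iff by (rule has_vec_integral_translation)
  have T1_split: "T1 (t + h - r) b = T1 h (T1 (t - r) b)" if "r \<le> t" for r b
    using T1_add[OF h, of "t - r"] that by (simp add: add_diff_eq add.commute)
  \<comment> \<open>At \<open>r = t\<close> both pieces may be nonzero, so that single point is
    excluded.\<close>
  have eq: "integrand (t + h) u r = (if r < t then ?f r else ?g r)" if "r \<noteq> t" for r
  proof -
    have "T1 (h - (r - t)) = T1 (t + h - r)" by (simp add: algebra_simps)
    then show ?thesis
      using that t h by (cases "r < t") (auto simp: integrand_def indicator_def T1_split blinfun.scaleR_right simp del: diff_diff_eq2 diff_diff_eq)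
  qed
  have "has_vec_integral lebesgue (integrand (t + h) u) (T1 h (j y) + j z)"
  proof (rule has_vec_integral_add[OF f g])
    \<comment> \<open>The case distinction gives Borel measurability without forming the sum of the
      two pieces.\<close>
    have "integrand (t + h) u = (\<lambda>r. if r = t then integrand (t + h) u t else if r < t then ?f r else ?g r)"
      using eq by auto
    also have "\<dots> \<in> borel_measurable lebesgue"
      using f g by (intro measurable_If) (auto simp: has_vec_integral_def)
    finally show "integrand (t + h) u \<in> borel_measurable lebesgue" .
    show "AE r in lebesgue. integrand (t + h) u r = ?f r + ?g r"
      using AE_lebesgue_singleton[of t]
    proof eventually_elim
      case (elim r)
      then show ?case
        unfolding eq[OF elim] using t h by (auto simp: integrand_def indicator_def)
    qed
  qed
  then show ?thesis
    unfolding integral_in_iff using T1_extends[OF h] linear_add[OF j_linear] by simp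
qed

lemma integral_in_zero: "integral_in 0 u 0"
proof -
  have "has_vec_integral lebesgue (integrand 0 u) (0 + 0)"
  proof (rule has_vec_integral_add[OF has_vec_integral_zero has_vec_integral_zero])
    have eq: "integrand 0 u = (\<lambda>r. if r = 0 then integrand 0 u 0 else 0)"
      by (auto simp: integrand_def)
    have "(\<lambda>r. if r = 0 then integrand 0 u 0 else 0) \<in> borel_measurable lebesgue"
      by (intro measurable_If) auto
    then show "integrand 0 u \<in> borel_measurable lebesgue" by (subst eq)
    show "AE r in lebesgue. integrand 0 u r = 0 + 0"
      using AE_lebesgue_singleton[of 0] by eventually_elim (auto simp: integrand_def)
  qed
  then show ?thesis unfolding integral_in_iff using linear_0[OF j_linear] by simp
qed

lemma integral_in_exists_Lq:
  assumes u: "u \<in> Lp_space q" and t: "0 \<le> t"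
  shows "\<exists>y. integral_in t u y"
proof -
  obtain t0 where t0: "0 < t0" and adm: "\<And>u. u \<in> Lp_space q \<Longrightarrow> \<exists>y. integral_in t0 u y"
    using admissible unfolding admissible_def by blast
  have "\<exists>y. integral_in t u y" if "u \<in> Lp_space q" "0 \<le> t" "t \<le> real n * t0" for n t u
    using that
  proof (induction n arbitrary: t u)
    case 0
    then show ?case using integral_in_zero by (intro exI[of _ 0]) auto
  next
    case (Suc n)
    show ?case
    proof (cases "t \<le> t0")
      case True
      then have "0 \<le> t0 - t" by simp
      from adm[OF Lp_space_delay(1)[OF q(1) Suc.prems(1) this]] show ?thesis
        using integral_in_delay[OF True] by blast
    next
      case False
      then have t: "0 \<le> t - t0" "t - t0 \<le> real n * t0"
        using Suc.prems by (auto simp: algebra_simps)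
      \<comment> \<open>The last block of length \<open>t0\<close> is split off: admissibility
        handles the shifted input there, the induction hypothesis the same input before it.\<close>
      then obtain y z where "integral_in (t - t0) u y" "integral_in t0 (\<lambda>s. u (t - t0 + s)) z"
        using Suc.IH[OF Suc.prems(1) t] adm[OF Lp_space_shift(1)[OF q(1) Suc.prems(1) t(1)]] by blast
      from integral_in_add[OF t(1) _ this] t0 show ?thesis by auto
    qed
  qed
  moreover obtain n where "t / t0 \<le> real n" using real_arch_simple by blast
  ultimately show ?thesis using u t t0 by (auto simp: field_simps)
qed

lemma integral_in_truncate: "integral_in t u y \<longleftrightarrow> integral_in t (\<lambda>s. indicator {0..t} s *\<^sub>R u s) y"
  by (rule integral_in_cong) simp

lemma integral_in_exists:
  assumes p: "q \<le> p" and u: "u \<in> Lp_space p" and t: "0 \<le> t"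
  shows "\<exists>y. integral_in t u y"
  using integral_in_exists_Lq[OF Lp_space_local_mono(1)[OF q(1) p q(2) u t] t] integral_in_truncate by blast

lemma \<Phi>_integral:
  assumes "q \<le> p" "u \<in> Lp_space p" "0 \<le> t"
  shows "integral_in t u (\<Phi> t u)"
  using integral_in_exists[OF assms] \<Phi>_eq by auto

lemma \<Phi>_truncate: "\<Phi> t (\<lambda>s. indicator {0..t} s *\<^sub>R u s) = \<Phi> t u"
  unfolding \<Phi>_def by (rule arg_cong[where f = The], rule ext, rule integral_in_truncate[symmetric])

lemma \<Phi>_plus:
  assumes p: "q \<le> p" and u: "u \<in> Lp_space p" and v: "v \<in> Lp_space p" and t: "0 \<le> t"
  shows "\<Phi> t (\<lambda>s. u s + v s) = \<Phi> t u + \<Phi> t v"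
proof -
  have p1: "1 \<le> p" using p q by auto
  note int = \<Phi>_integral[OF p _ t, unfolded integral_in_iff]
  have "j (\<Phi> t (\<lambda>s. u s + v s)) = j (\<Phi> t u) + j (\<Phi> t v)"
    by (rule has_vec_integral_sum_eq[OF int[OF u] int[OF v] int[OF Lp_space_add(1)[OF p1 u v]]])
       (simp add: integrand_def blinfun.add_right scaleR_add_right)
  then show ?thesis using j_inj linear_add[OF j_linear] by (metis injD)
qed

lemma \<Phi>_scaleR:
  assumes p: "q \<le> p" and u: "u \<in> Lp_space p" and t: "0 \<le> t"
  shows "\<Phi> t (\<lambda>s. c *\<^sub>R u s) = c *\<^sub>R \<Phi> t u"
proof (rule \<Phi>_eq)
  have "has_vec_integral lebesgue (\<lambda>r. c *\<^sub>R integrand t u r) (c *\<^sub>R j (\<Phi> t u))"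
    by (rule has_vec_integral_bounded_linear[OF bounded_linear_scaleR_right])
       (rule \<Phi>_integral[OF p u t, unfolded integral_in_iff])
  moreover have "(\<lambda>r. c *\<^sub>R integrand t u r) = integrand t (\<lambda>s. c *\<^sub>R u s)"
    by (auto simp: integrand_def blinfun.scaleR_right)
  ultimately show "integral_in t (\<lambda>s. c *\<^sub>R u s) (c *\<^sub>R \<Phi> t u)"
    unfolding integral_in_iff using linear_scale[OF j_linear] by metis
qed

lemma \<Phi>_add_time:
  assumes p: "q \<le> p" and u: "u \<in> Lp_space p" and t: "0 \<le> t" and h: "0 \<le> h"
  shows "\<Phi> (t + h) u = T h (\<Phi> t u) + \<Phi> h (\<lambda>s. u (t + s))"
proof (rule \<Phi>_eq[OF integral_in_add[OF t h]])
  have p1: "1 \<le> p" using p q by auto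
  show "integral_in t u (\<Phi> t u)" by (rule \<Phi>_integral[OF p u t])
  show "integral_in h (\<lambda>s. u (t + s)) (\<Phi> h (\<lambda>s. u (t + s)))"
    by (rule \<Phi>_integral[OF p Lp_space_shift(1)[OF p1 u t] h])
qed

text \<open>The constant may grow with \<open>t\<close>: this bound only supplies the individual
  continuity that uniform boundedness requires at a fixed time.\<close>

lemma norm_j_\<Phi>_le:
  assumes u: "u \<in> Lp_space q" and t: "0 \<le> t"
  shows "norm (j (\<Phi> t u)) \<le> M * norm B * (1 + t) * Lp_norm q u"
proof -
  have u1: "(\<lambda>s. indicator {0..t} s *\<^sub>R u s) \<in> Lp_space q"
    by (intro Lp_space_indicator q u) auto
  have sm: "strongly_measurable lebesgue (\<lambda>s. indicator {0..} s *\<^sub>R (indicator {0..t} s *\<^sub>R u s))"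
    using u1 by (simp add: Lp_space_def strongly_measurable_restrict_space)
  also have "(\<lambda>s. indicator {0..} s *\<^sub>R (indicator {0..t} s *\<^sub>R u s)) = (\<lambda>s. indicator {0..t} s *\<^sub>R u s)"
    by (auto simp: indicator_def)
  finally have [measurable]: "(\<lambda>s. norm (indicator {0..t} s *\<^sub>R u s)) \<in> borel_measurable lebesgue"
    by (rule completion.borel_measurable_norm)
  have "norm (integrand t u r) \<le> M * norm B * norm (indicator {0..t} r *\<^sub>R u r)" for r
  proof (cases "r \<in> {0..t}")
    case True
    then have "norm (T1 (t - r) (B (u r))) \<le> norm (T1 (t - r)) * norm (B (u r))"
      by (intro norm_blinfun)
    also have "\<dots> \<le> M * (norm B * norm (u r))"
      using True M by (intro mult_mono T1_bound norm_blinfun) auto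
    finally show ?thesis using True by (simp add: integrand_def mult.assoc)
  qed (simp add: integrand_def)
  then have "(\<integral>\<^sup>+r. ennreal (norm (integrand t u r)) \<partial>lebesgue) \<le>
      (\<integral>\<^sup>+r. ennreal (M * norm B) * ennreal (norm (indicator {0..t} r *\<^sub>R u r)) \<partial>lebesgue)"
    using M by (intro nn_integral_mono) (simp add: ennreal_mult[symmetric] ennreal_leI)
  also have "\<dots> = ennreal (M * norm B) * (\<integral>\<^sup>+r. ennreal (norm (indicator {0..t} r *\<^sub>R u r)) \<partial>lebesgue)"
    by (rule nn_integral_cmult) measurable
  also have "\<dots> \<le> ennreal (M * norm B) * ennreal ((1 + t) * Lp_norm q u)"
    by (intro mult_left_mono nn_integral_local_le q u t) simp
  also have "\<dots> = ennreal (M * norm B * (1 + t) * Lp_norm q u)"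
    using M t by (simp add: ennreal_mult[symmetric] Lp_norm_nonneg mult.assoc)
  finally have "ennreal (norm (j (\<Phi> t u))) \<le> ennreal (M * norm B * (1 + t) * Lp_norm q u)"
    using has_vec_integral_norm_le[OF \<Phi>_integral[OF order_refl u t, unfolded integral_in_iff]] by simp
  then show ?thesis
    using M t by (simp add: ennreal_le_iff Lp_norm_nonneg)
qed

text \<open>The operators \<open>V n \<circ> \<Phi> t\<close> are bounded because \<open>V n\<close> only sees the extrapolation norm, and
  they converge pointwise to \<open>\<Phi> t\<close>; this replaces the closed graph theorem.\<close>

lemma norm_\<Phi>_le_Lq:
  assumes t: "0 \<le> t"
  shows "\<exists>C\<ge>0. \<forall>u\<in>Lp_space q. norm (\<Phi> t u) \<le> C * Lp_norm q u"
proof -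
  interpret input_space "Lp_space q :: (real \<Rightarrow> 'u) set" "Lp_norm q"
    by (rule input_space_Lp[OF q(1)])
  have "\<exists>C. \<forall>n. \<forall>u\<in>Lp_space q. norm (V n (\<Phi> t u)) \<le> C * Lp_norm q u"
  proof (rule uniform_boundedness)
    fix u v :: "real \<Rightarrow> 'u" and n c
    assume u: "u \<in> Lp_space q"
    show "norm (V n (\<Phi> t (\<lambda>s. c *\<^sub>R u s))) = \<bar>c\<bar> * norm (V n (\<Phi> t u))"
      by (simp add: \<Phi>_scaleR[OF order_refl u t] linear_scale[OF V_linear])
    show "norm (V n (\<Phi> t (\<lambda>s. u s + v s))) \<le> norm (V n (\<Phi> t u)) + norm (V n (\<Phi> t v))"
      if v: "v \<in> Lp_space q"
      by (simp add: \<Phi>_plus[OF order_refl u v t] linear_add[OF V_linear] norm_triangle_ineq)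
    show "bdd_above (range (\<lambda>n. norm (V n (\<Phi> t u))))"
      by (rule bounded_imp_bdd_above[OF convergent_imp_bounded[OF tendsto_norm[OF V_lim]]])
  next
    fix n
    obtain c where c: "\<And>x. norm (V n x) \<le> c * norm (j x)" using V_bound by blast
    have "norm (V n (\<Phi> t u)) \<le> \<bar>c\<bar> * (M * norm B * (1 + t)) * Lp_norm q u" if u: "u \<in> Lp_space q" for u
    proof -
      have "norm (V n (\<Phi> t u)) \<le> \<bar>c\<bar> * norm (j (\<Phi> t u))"
        by (rule order_trans[OF c]) (simp add: mult_right_mono)
      also have "\<dots> \<le> \<bar>c\<bar> * (M * norm B * (1 + t) * Lp_norm q u)"
        by (intro mult_left_mono norm_j_\<Phi>_le u t) simp
      finally show ?thesis by (simp add: mult.assoc)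
    qed
    then show "\<exists>c. \<forall>u\<in>Lp_space q. norm (V n (\<Phi> t u)) \<le> c * Lp_norm q u" by blast
  qed (rule Lp_space_complete[OF q(1)])
  then obtain C where C: "\<And>n u. u \<in> Lp_space q \<Longrightarrow> norm (V n (\<Phi> t u)) \<le> C * Lp_norm q u" by blast
  have "norm (\<Phi> t u) \<le> \<bar>C\<bar> * Lp_norm q u" if u: "u \<in> Lp_space q" for u
  proof (rule LIMSEQ_le_const2[OF tendsto_norm[OF V_lim]])
    have "C * Lp_norm q u \<le> \<bar>C\<bar> * Lp_norm q u"
      by (intro mult_right_mono Lp_norm_nonneg) simp
    then show "\<exists>N. \<forall>n\<ge>N. norm (V n (\<Phi> t u)) \<le> \<bar>C\<bar> * Lp_norm q u"
      using C[OF u] by (meson order_trans)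
  qed
  then show ?thesis by (intro exI[of _ "\<bar>C\<bar>"]) simp
qed

text \<open>The bound at the single time \<tau> suffices, because delaying the input by
  \<open>\<tau> - s\<close> reproduces the value at time \<open>s\<close> without increasing the
  norm.\<close>

lemma norm_\<Phi>_le_Lq_uniform:
  assumes \<tau>: "0 \<le> \<tau>"
  shows "\<exists>C\<ge>0. \<forall>s\<in>{0..\<tau>}. \<forall>u\<in>Lp_space q. norm (\<Phi> s u) \<le> C * Lp_norm q u"
proof -
  obtain C where C: "0 \<le> C" "\<And>u. u \<in> Lp_space q \<Longrightarrow> norm (\<Phi> \<tau> u) \<le> C * Lp_norm q u"
    using norm_\<Phi>_le_Lq[OF \<tau>] by blast
  have "norm (\<Phi> s u) \<le> C * Lp_norm q u" if s: "s \<in> {0..\<tau>}" and u: "u \<in> Lp_space q" for s u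
  proof -
    let ?v = "\<lambda>r. indicator {\<tau> - s..} r *\<^sub>R u (r - (\<tau> - s))"
    have s': "0 \<le> \<tau> - s" "s \<le> \<tau>" using s by auto
    note v = Lp_space_delay[OF q(1) u s'(1)]
    have "\<Phi> s u = \<Phi> \<tau> ?v"
      by (rule \<Phi>_eq[OF integral_in_delay[OF s'(2) \<Phi>_integral[OF order_refl v(1) \<tau>]]])
    also have "norm \<dots> \<le> C * Lp_norm q ?v" by (rule C(2)[OF v(1)])
    also have "\<dots> \<le> C * Lp_norm q u" by (intro mult_left_mono v C)
    finally show ?thesis .
  qed
  with C(1) show ?thesis by blast
qed

section \<open>Bounds for all times and continuity in time\<close>

lemma norm_T_le: "0 \<le> t \<Longrightarrow> norm (T t x) \<le> M * exp (- \<omega> * t) * norm x"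
  using norm_blinfun[of "T t" x] mult_right_mono[OF T_bound norm_ge_zero, of t x] by linarith

lemma norm_\<Phi>_le:
  assumes p: "q \<le> p"
  shows "\<exists>K\<ge>0. \<forall>t\<ge>0. \<forall>u\<in>Lp_space p. norm (\<Phi> t u) \<le> K * Lp_norm p u"
proof -
  have p1: "1 \<le> p" using p q by auto
  \<comment> \<open>This makes \<open>M * exp (- \<omega> * \<tau>)\<close> equal to
    \<open>M / (2 * M + 1)\<close>, just below one half.\<close>
  define \<tau> where "\<tau> = ln (2 * M + 1) / \<omega>"
  have \<tau>: "0 < \<tau>" "M * exp (- \<omega> * \<tau>) < 1 / 2"
    using M \<omega> by (auto simp: \<tau>_def exp_minus field_simps)
  obtain C where C: "0 \<le> C" "\<And>s u. 0 \<le> s \<Longrightarrow> s \<le> \<tau> \<Longrightarrow> u \<in> Lp_space q \<Longrightarrow> norm (\<Phi> s u) \<le> C * Lp_norm q u"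
    using norm_\<Phi>_le_Lq_uniform[of \<tau>] \<tau> by auto
  define K where "K = C * (1 + \<tau>)"
  have K: "0 \<le> K" using C \<tau> by (simp add: K_def)
  have short: "norm (\<Phi> s u) \<le> K * Lp_norm p u" if s: "0 \<le> s" "s \<le> \<tau>" and u: "u \<in> Lp_space p" for s u
  proof -
    note loc = Lp_space_local_mono[OF q(1) p q(2) u s(1)]
    have "norm (\<Phi> s u) \<le> C * Lp_norm q (\<lambda>r. indicator {0..s} r *\<^sub>R u r)"
      using C(2)[OF s loc(1)] by (simp add: \<Phi>_truncate)
    also have "\<dots> \<le> C * ((1 + \<tau>) * Lp_norm p u)"
      using s by (intro mult_left_mono order_trans[OF loc(2)] mult_right_mono C Lp_norm_nonneg) auto
    finally show ?thesis by (simp add: K_def mult.assoc)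
  qed
  \<comment> \<open>\<open>2 * K\<close> is the fixed point of halving and adding \<open>K\<close>,
    which is the effect of one more block of length \<tau>.\<close>
  have "norm (\<Phi> t u) \<le> 2 * K * Lp_norm p u"
    if "0 \<le> t" "t \<le> real n * \<tau>" "u \<in> Lp_space p" for n t u
    using that
  proof (induction n arbitrary: t u)
    case 0
    have "0 \<le> K * Lp_norm p u" using K Lp_norm_nonneg[of p u] by simp
    then show ?case using short[of t u] 0 \<tau> by auto
  next
    case (Suc n)
    show ?case
    proof (cases "t \<le> \<tau>")
      case True
      have "0 \<le> K * Lp_norm p u" using K Lp_norm_nonneg[of p u] by simp
      then show ?thesis using short[of t u] Suc.prems True by auto
    next
      case False
      then have t: "0 \<le> t - \<tau>" "t - \<tau> \<le> real n * \<tau>"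
        using Suc.prems by (auto simp: algebra_simps)
      note u = Suc.prems(3)
      note shift = Lp_space_shift[OF p1 u t(1)]
      have "\<Phi> t u = T \<tau> (\<Phi> (t - \<tau>) u) + \<Phi> \<tau> (\<lambda>s. u (t - \<tau> + s))"
        using \<Phi>_add_time[OF p u t(1), of \<tau>] \<tau> by simp
      then have "norm (\<Phi> t u) \<le> norm (T \<tau> (\<Phi> (t - \<tau>) u)) + norm (\<Phi> \<tau> (\<lambda>s. u (t - \<tau> + s)))"
        by (simp add: norm_triangle_ineq)
      also have "norm (T \<tau> (\<Phi> (t - \<tau>) u)) \<le> M * exp (- \<omega> * \<tau>) * norm (\<Phi> (t - \<tau>) u)"
        using \<tau> by (intro norm_T_le) simp
      also have "\<dots> \<le> 1 / 2 * (2 * K * Lp_norm p u)"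
        using \<tau> by (intro mult_mono Suc.IH t u) auto
      also have "norm (\<Phi> \<tau> (\<lambda>s. u (t - \<tau> + s))) \<le> K * Lp_norm p u"
        using \<tau> by (intro order_trans[OF short[OF _ _ shift(1)]] mult_left_mono shift K) auto
      finally show ?thesis by simp
    qed
  qed
  moreover have "\<exists>n. t \<le> real n * \<tau>" for t
    using real_arch_simple[of "t / \<tau>"] \<tau> by (auto simp: field_simps)
  ultimately have "norm (\<Phi> t u) \<le> 2 * K * Lp_norm p u" if "0 \<le> t" "u \<in> Lp_space p" for t u
    using that by blast
  with K show ?thesis by (intro exI[of _ "2 * K"]) auto
qed

text \<open>Factoring out the semigroup at the smaller of two times reduces continuity from both
  sides to continuity from the right at 0, with \<open>M\<close> as a uniform modulus
  factor.\<close>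

lemma continuous_on_T: "continuous_on {0..} (\<lambda>t. T t x)"
proof -
  have le: "norm (T t x - T s x) \<le> M * norm (T (t - s) x - x)" if "0 \<le> s" "s \<le> t" for s t
  proof -
    have "T t = T s o\<^sub>L T (t - s)"
      using C0 that unfolding C0_semigroup_def by (metis add_diff_cancel_left' diff_ge_0_iff_ge le_add_diff_inverse)
    then have "T t x - T s x = T s (T (t - s) x - x)"
      by (simp add: blinfun.diff_right)
    then have "norm (T t x - T s x) \<le> M * exp (- \<omega> * s) * norm (T (t - s) x - x)"
      using norm_T_le[OF that(1)] by simp
    also have "\<dots> \<le> M * norm (T (t - s) x - x)"
      using M \<omega> that by (intro mult_right_mono) (auto simp: mult_le_cancel_left1)
    finally show ?thesis .
  qed
  show ?thesis
  proof (rule continuous_onI)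
    fix t e :: real assume t: "t \<in> {0..}" and e: "0 < e"
    have "((\<lambda>h. T h x) \<longlongrightarrow> x) (at_right 0)"
      using C0 by (simp add: C0_semigroup_def)
    then have "\<forall>\<^sub>F h in at_right 0. dist (T h x) x < e / M"
      using e M by (intro tendstoD) auto
    then obtain d where d: "0 < d" "\<And>h. 0 < h \<Longrightarrow> h < d \<Longrightarrow> norm (T h x - x) < e / M"
      unfolding eventually_at_right_field dist_norm by blast
    have small: "norm (T b x - T c x) < e" if "0 \<le> c" "c < b" "b - c < d" for b c
    proof -
      have "norm (T b x - T c x) \<le> M * norm (T (b - c) x - x)" using that by (intro le) auto
      also have "\<dots> < M * (e / M)" using that M d(2)[of "b - c"] by (intro mult_strict_left_mono) auto
      finally show ?thesis using M by simp
    qed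
    have "dist (T s x) (T t x) \<le> e" if s: "s \<in> {0..}" "dist s t < d" for s
      using small[of t s] small[of s t] s t e
      by (cases s t rule: linorder_cases) (auto simp: dist_norm norm_minus_commute abs_if split: if_splits)
    with d(1) show "\<exists>d>0. \<forall>s\<in>{0..}. dist s t < d \<longrightarrow> dist (T s x) (T t x) \<le> e" by blast
  qed
qed

text \<open>On a short interval \<open>[c, c']\<close> around \<open>t\<close> the map \<open>\<lambda>s. \<Phi> s u\<close> is the orbit of \<open>\<Phi> c u\<close> up to an
  error controlled by the norm of \<open>u\<close> on \<open>[c, c']\<close>; this avoids the continuity of translations in
  \<open>L\<^sub>p\<close>.\<close>

lemma continuous_on_\<Phi>:
  assumes p: "q \<le> p" and u: "u \<in> Lp_space p"
  shows "continuous_on {0..} (\<lambda>t. \<Phi> t u)"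
proof (rule continuous_onI)
  fix t e :: real assume t: "t \<in> {0..}" and e: "0 < e"
  \<comment> \<open>The horizon 2 covers every \<open>s - c\<close> below, which is at most
    \<open>2 * \<delta>\<close> with \<open>\<delta> \<le> 1\<close>.\<close>
  obtain C where C: "0 \<le> C" "\<And>s u. 0 \<le> s \<Longrightarrow> s \<le> 2 \<Longrightarrow> u \<in> Lp_space q \<Longrightarrow> norm (\<Phi> s u) \<le> C * Lp_norm q u"
    using norm_\<Phi>_le_Lq_uniform[of 2] by auto
  let ?w = "\<lambda>s. indicator {0..t + 1} s *\<^sub>R u s"
  have w: "?w \<in> Lp_space q"
    using t by (intro Lp_space_local_mono(1)[OF q(1) p q(2) u]) auto
  \<comment> \<open>After multiplication by \<open>C\<close> this leaves at most
    \<open>e / 4\<close> for each of the two comparisons with the orbit; the orbit itself is allowed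
    \<open>e / 2\<close>.\<close>
  have "0 < e / (4 * (C + 1))" using e C by simp
  from order_tendstoD(2)[OF Lp_norm_shrinking_interval[OF q w, of t] this]
  obtain n where n: "Lp_norm q (\<lambda>s. indicator {t - 1 / Suc n..t + 1 / Suc n} s *\<^sub>R ?w s) < e / (4 * (C + 1))"
    by (auto dest!: eventually_happens)
  define \<delta> where "\<delta> = 1 / real (Suc n)"
  have \<delta>: "0 < \<delta>" "\<delta> \<le> 1" by (auto simp: \<delta>_def field_simps)
  \<comment> \<open>The comparison orbit starts to the left of \<open>t\<close> where possible, so
    that both sides of \<open>t\<close> are treated at once; near time 0 it starts at 0.\<close>
  define c where "c = max 0 (t - \<delta>)"
  have c: "0 \<le> c" "c \<le> t" using t \<delta> by (auto simp: c_def)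
  define z where "z = \<Phi> c u"
  have near: "norm (\<Phi> s u - T (s - c) z) \<le> e / 4" if s: "c \<le> s" "s \<le> t + \<delta>" for s
  proof -
    let ?v = "\<lambda>r. indicator {0..s - c} r *\<^sub>R u (c + r)"
    let ?g = "\<lambda>r. indicator {t - \<delta>..t + \<delta>} r *\<^sub>R ?w r"
    have g: "?g \<in> Lp_space q" by (intro Lp_space_indicator q w) auto
    note shift = Lp_space_shift[OF q(1) g c(1)]
    have v_eq: "?v = (\<lambda>r. indicator {0..s - c} r *\<^sub>R ?g (c + r))"
    proof
      fix r
      have "?g (c + r) = u (c + r)" if "r \<in> {0..s - c}"
      proof -
        have "c + r \<in> {t - \<delta>..t + \<delta>}" "c + r \<in> {0..t + 1}"
          using that s \<delta> c by (auto simp: c_def)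
        then show ?thesis by simp
      qed
      then show "?v r = indicator {0..s - c} r *\<^sub>R ?g (c + r)"
        by (cases "r \<in> {0..s - c}") (simp, simp only: indicator_simps scaleR_zero_left not_False_eq_True)
    qed
    have v: "?v \<in> Lp_space q" "Lp_norm q ?v \<le> Lp_norm q ?g"
      unfolding v_eq using Lp_space_indicator[OF q(1) shift(1), of "{0..s - c}"] shift(2) by auto
    have "\<Phi> s u - T (s - c) z = \<Phi> (s - c) (\<lambda>r. u (c + r))"
      using \<Phi>_add_time[OF p u c(1), of "s - c"] s by (simp add: z_def)
    also have "\<dots> = \<Phi> (s - c) ?v" by (simp add: \<Phi>_truncate)
    also have "norm \<dots> \<le> C * Lp_norm q ?v"
      using s \<delta> by (intro C(2) v) (auto simp: c_def)
    also have "\<dots> \<le> C * (e / (4 * (C + 1)))"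
      using v(2) n by (intro mult_left_mono C) (simp add: \<delta>_def)
    also have "\<dots> \<le> e / 4" using C e by (simp add: field_simps)
    finally show ?thesis .
  qed
  \<comment> \<open>The absolute value extends the orbit to the whole line, so that continuity is
    two-sided even when \<open>t = c = 0\<close>.\<close>
  have "isCont (\<lambda>s. T \<bar>s\<bar> z) (t - c)"
  proof -
    have "continuous_on UNIV (\<lambda>s. T \<bar>s\<bar> z)"
      by (rule continuous_on_compose2[OF continuous_on_T]) (auto intro: continuous_intros)
    then show ?thesis by (simp add: continuous_on_eq_continuous_at)
  qed
  then obtain d where d: "0 < d" "\<And>s. dist s (t - c) < d \<Longrightarrow> dist (T \<bar>s\<bar> z) (T \<bar>t - c\<bar> z) < e / 2"
    unfolding continuous_at_eps_delta using e by (meson half_gt_zero)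
  have "dist (\<Phi> s u) (\<Phi> t u) \<le> e" if s: "s \<in> {0..}" "dist s t < min d \<delta>" for s
  proof -
    have sc: "c \<le> s" "s \<le> t + \<delta>"
      using s by (auto simp: c_def dist_real_def abs_if split: if_splits)
    have "dist (T (s - c) z) (T (t - c) z) < e / 2"
      using d(2)[of "s - c"] s sc c by (simp add: dist_real_def)
    moreover have "dist (\<Phi> s u) (T (s - c) z) \<le> e / 4" "dist (\<Phi> t u) (T (t - c) z) \<le> e / 4"
      using near[OF sc] near[of t] c \<delta> by (auto simp: dist_norm)
    ultimately show ?thesis
      using dist_triangle[of "\<Phi> s u" "\<Phi> t u" "T (s - c) z"]
        dist_triangle[of "T (s - c) z" "\<Phi> t u" "T (t - c) z"] by (simp add: dist_commute)
  qed
  moreover have "0 < min d \<delta>" using d \<delta> by simp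
  ultimately show "\<exists>d>0. \<forall>s\<in>{0..}. dist s t < d \<longrightarrow> dist (\<Phi> s u) (\<Phi> t u) \<le> e" by blast
qed

section \<open>The mild solution as an ISS control system\<close>

lemma mild_domain_eq:
  assumes p: "q \<le> p"
  shows "mild_domain j T1 B (Lp_space p) = {0..} \<times> UNIV \<times> Lp_space p"
  using integral_in_exists[OF p] by (auto simp: mild_domain_def)

lemma mild_solution_eq: "mild_solution T j T1 B t x u = T t x + \<Phi> t u"
  by (simp add: mild_solution_def \<Phi>_def)

lemma T_add: "0 \<le> t \<Longrightarrow> 0 \<le> h \<Longrightarrow> T (t + h) x = T h (T t x)"
  using C0 unfolding C0_semigroup_def by (metis add.commute blinfun_apply_blinfun_compose)

lemma mild_control_system:
  assumes p: "q \<le> p"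
  shows "control_system (Lp_space p) (Lp_norm p) (mild_domain j T1 B (Lp_space p)) (mild_solution T j T1 B)"
proof (intro control_system.intro control_system_axioms.intro input_space_Lp)
  show p1: "1 \<le> p" using p q by auto
  note dom = mild_domain_eq[OF p] and sol = mild_solution_eq
  fix t h :: real and x :: 'x and u v :: "real \<Rightarrow> 'u"
  show "mild_domain j T1 B (Lp_space p) \<subseteq> {0..} \<times> (UNIV :: 'x set) \<times> Lp_space p"
    by (simp add: dom)
  show "\<exists>tm::ereal. 0 < tm \<and> (\<forall>t. (t, x, u) \<in> mild_domain j T1 B (Lp_space p) \<longleftrightarrow> 0 \<le> t \<and> ereal t < tm)"
    if "u \<in> Lp_space p"
    using that by (intro exI[of _ \<infinity>]) (simp add: dom)
  show "(t, x, v) \<in> mild_domain j T1 B (Lp_space p) \<and> mild_solution T j T1 B t x u = mild_solution T j T1 B t x v"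
    if "(t, x, u) \<in> mild_domain j T1 B (Lp_space p)" and v: "v \<in> Lp_space p"
      and zero: "Lp_norm p (\<lambda>s. u s - v s) = 0"
  proof -
    have u: "u \<in> Lp_space p" and t: "0 \<le> t" using that by (auto simp: dom)
    interpret input_space "Lp_space p :: (real \<Rightarrow> 'u) set" "Lp_norm p"
      by (rule input_space_Lp[OF p1])
    \<comment> \<open>Independence of the representative follows from linearity and the norm bound:
      a difference of norm 0 is mapped to 0.\<close>
    note d = diff_in[OF u v]
    obtain K where "norm (\<Phi> t (\<lambda>s. u s - v s)) \<le> K * Lp_norm p (\<lambda>s. u s - v s)"
      using norm_\<Phi>_le[OF p] t d by blast
    with zero have "\<Phi> t (\<lambda>s. u s - v s) = 0" by simp
    then have "\<Phi> t u = \<Phi> t v"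
      using \<Phi>_plus[OF p v d t] by simp
    then show ?thesis using v t by (simp add: dom sol)
  qed
  show "mild_solution T j T1 B 0 x u = x"
    using \<Phi>_eq[OF integral_in_zero] C0 by (simp add: sol C0_semigroup_def)
  show "{0..t} \<times> {(x, v)} \<subseteq> mild_domain j T1 B (Lp_space p) \<and>
      mild_solution T j T1 B t x u = mild_solution T j T1 B t x v"
    if "(t, x, u) \<in> mild_domain j T1 B (Lp_space p)" and v: "v \<in> Lp_space p" and "\<forall>s\<in>{0..t}. v s = u s"
  proof -
    have "\<Phi> t u = \<Phi> t v"
      unfolding \<Phi>_def by (rule arg_cong[where f = The], rule ext, rule integral_in_cong) (use that in auto)
    then show ?thesis using v by (auto simp: dom sol)
  qed
  assume u: "u \<in> Lp_space p"
  have "{t. (t, x, u) \<in> mild_domain j T1 B (Lp_space p)} = {0..}"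
    using u by (auto simp: dom)
  then show "continuous_on {t. (t, x, u) \<in> mild_domain j T1 B (Lp_space p)} (\<lambda>t. mild_solution T j T1 B t x u)"
    by (simp add: sol continuous_on_add continuous_on_T continuous_on_\<Phi>[OF p u])
  assume t: "0 \<le> t" and h: "0 \<le> h"
  then show "(h, mild_solution T j T1 B t x u, \<lambda>s. u (t + s)) \<in> mild_domain j T1 B (Lp_space p) \<and>
      mild_solution T j T1 B h (mild_solution T j T1 B t x u) (\<lambda>s. u (t + s)) = mild_solution T j T1 B (t + h) x u"
    using Lp_space_shift(1)[OF p1 u t]
    by (simp add: dom sol T_add \<Phi>_add_time[OF p u] blinfun.add_right)
qed

theorem mild_ISS:
  assumes p: "q \<le> p"
  shows "ISS_control_system (Lp_space p) (Lp_norm p)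
    (mild_domain j T1 B (Lp_space p)) (mild_solution T j T1 B)"
proof -
  obtain K where K: "0 \<le> K" "\<And>t u. 0 \<le> t \<Longrightarrow> u \<in> Lp_space p \<Longrightarrow> norm (\<Phi> t u) \<le> K * Lp_norm p u"
    using norm_\<Phi>_le[OF p] by blast
  define \<beta> where "\<beta> r t = M * exp (- \<omega> * t) * r" for r t :: real
  \<comment> \<open>The slope is \<open>K + 1\<close> because \<open>K\<close> may be 0, whereas a
    gain must be strictly increasing and unbounded.\<close>
  define \<gamma> where "\<gamma> r = (K + 1) * r" for r :: real
  have "((\<lambda>t. exp (- \<omega> * t)) \<longlongrightarrow> 0) at_top"
    using \<omega> by (intro filterlim_compose[OF exp_at_bot] filterlim_tendsto_neg_mult_at_bot[OF tendsto_const])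
      (auto intro: filterlim_ident)
  then have "(\<beta> r \<longlongrightarrow> 0) at_top" for r
    unfolding \<beta>_def using tendsto_mult_right_zero tendsto_mult_left_zero by blast
  moreover have "continuous_on ({0..} \<times> {0..}) (\<lambda>(r, t). \<beta> r t)"
    unfolding \<beta>_def case_prod_unfold by (intro continuous_intros)
  moreover have "strict_mono_on {0..} (\<lambda>r. \<beta> r t)" "\<beta> 0 t = 0" for t
    using M by (auto simp: \<beta>_def strict_mono_on_def)
  moreover have "strict_antimono_on {0..} (\<beta> r)" if "0 < r" for r
    using M \<omega> that by (auto simp: \<beta>_def monotone_on_def)
  ultimately have \<beta>: "\<beta> \<in> class_KL"
    by (simp add: class_KL_def)
  have "\<not> bounded (\<gamma> ` {0..})"
  proof
    assume "bounded (\<gamma> ` {0..})"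
    then obtain b where b: "\<And>r. 0 \<le> r \<Longrightarrow> \<bar>\<gamma> r\<bar> \<le> b" by (auto simp: bounded_iff)
    have "\<gamma> (\<bar>b\<bar> + 1) = K * (\<bar>b\<bar> + 1) + \<bar>b\<bar> + 1" by (simp add: \<gamma>_def algebra_simps)
    moreover have "0 \<le> K * (\<bar>b\<bar> + 1)" using K by simp
    ultimately show False using b[of "\<bar>b\<bar> + 1"] by linarith
  qed
  then have \<gamma>: "\<gamma> \<in> class_K_inf"
    using K by (auto simp: class_K_inf_def \<gamma>_def strict_mono_on_def intro!: continuous_intros)
  have "norm (mild_solution T j T1 B t x u) \<le> \<beta> (norm x) t + \<gamma> (Lp_norm p u)"
    if u: "u \<in> Lp_space p" and t: "0 \<le> t" for x u t
  proof -
    have "norm (mild_solution T j T1 B t x u) \<le> norm (T t x) + norm (\<Phi> t u)"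
      unfolding mild_solution_eq by (rule norm_triangle_ineq)
    also have "\<dots> \<le> \<beta> (norm x) t + K * Lp_norm p u"
      unfolding \<beta>_def by (intro add_mono norm_T_le t K u)
    also have "\<dots> \<le> \<beta> (norm x) t + \<gamma> (Lp_norm p u)"
      using Lp_norm_nonneg[of p u] by (simp add: \<gamma>_def distrib_right)
    finally show ?thesis .
  qed
  with \<beta> \<gamma> mild_control_system[OF p] mild_domain_eq[OF p] show ?thesis
    unfolding ISS_control_system_def forward_complete_def by blast
qed

end

section \<open>Passage from the generator and its extrapolation space\<close>

lemma generates_invariant:
  assumes gen: "generates D A T" and x: "x \<in> D" and t: "0 \<le> t"
  shows "T t x \<in> D" and "A (T t x) = T t (A x)"
proof -
  have lim: "((\<lambda>h. T t ((T h x - x) /\<^sub>R h)) \<longlongrightarrow> T t (A x)) (at_right 0)"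
    using gen x unfolding generates_def by (intro blinfun.tendsto tendsto_const) blast
  \<comment> \<open>The operators of the semigroup commute, so \<open>T t\<close> carries the
    difference quotients of \<open>x\<close> to those of \<open>T t x\<close>.\<close>
  have "\<forall>\<^sub>F h in at_right 0. T t ((T h x - x) /\<^sub>R h) = (T h (T t x) - T t x) /\<^sub>R h"
    unfolding eventually_at_right_field
  proof (intro exI[of _ 1] conjI allI impI)
    fix h :: real assume h: "0 < h"
    have "T t o\<^sub>L T h = T h o\<^sub>L T t"
      using gen t h unfolding generates_def C0_semigroup_def by (metis add.commute less_imp_le)
    then have "T t (T h x) = T h (T t x)" by (metis blinfun_apply_blinfun_compose)
    then show "T t ((T h x - x) /\<^sub>R h) = (T h (T t x) - T t x) /\<^sub>R h"
      by (simp add: blinfun.scaleR_right blinfun.diff_right)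
  qed simp
  with lim have "((\<lambda>h. (T h (T t x) - T t x) /\<^sub>R h) \<longlongrightarrow> T t (A x)) (at_right 0)"
    by (rule Lim_transform_eventually)
  then show "T t x \<in> D" "A (T t x) = T t (A x)"
    using gen unfolding generates_def by blast+
qed

text \<open>Since \<open>T t\<close> preserves \<open>D\<close> and commutes with \<open>A\<close>
  there, \<open>T t\<close> applied to the resolvent of \<open>y\<close> is the element of
  \<open>D\<close> that \<open>a I - A\<close> sends to \<open>T t y\<close>.\<close>

lemma resolvent_commutes:
  assumes gen: "generates D A T" and a: "a \<in> resolvent_set D A" and t: "0 \<le> t"
  shows "resolvent D A a (T t y) = T t (resolvent D A a y)"
proof -
  let ?R = "resolvent D A a"
  have bij: "bij_betw (\<lambda>x. a *\<^sub>R x - A x) D UNIV"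
    using a by (simp add: resolvent_set_def)
  have R: "?R y \<in> D" "a *\<^sub>R ?R y - A (?R y) = y" for y
    using bij unfolding resolvent_def bij_betw_def by (metis UNIV_I inv_into_into, metis UNIV_I f_inv_into_f)
  note inv = generates_invariant[OF gen R(1) t]
  have "?R (a *\<^sub>R T t (?R y) - A (T t (?R y))) = T t (?R y)"
    using inv_into_f_f[OF bij_betw_imp_inj_on[OF bij] inv(1)] by (simp only: resolvent_def)
  moreover have "a *\<^sub>R T t (?R y) - A (T t (?R y)) = T t (a *\<^sub>R ?R y - A (?R y))"
    by (simp add: inv(2) blinfun.scaleR_right blinfun.diff_right)
  ultimately show ?thesis by (simp add: R(2))
qed

text \<open>On \<open>X\<close> the extrapolation norm is the norm of \<open>R = (a I - A)\<^sup>-\<^sup>1\<close>, which commutes with the semigroup;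
  so the growth bound of \<open>T\<close> passes to \<open>T\<^sub>-\<^sub>1\<close> by density. The approximations of the identity are
  \<open>(a I - A\<^sub>h) R\<close>, where \<open>A\<^sub>h = (T h - I) / h\<close>.\<close>

lemma (in extrapolation_space) stable_input_systemI:
  fixes B :: "'u::banach \<Rightarrow>\<^sub>L 'e"
  assumes gen: "generates D A T" and stable: "exponentially_stable T"
    and q: "1 \<le> q" "q < \<infinity>" and admissible: "admissible j T1 B q"
  shows "\<exists>M \<omega> V. stable_input_system T j T1 B q M \<omega> V"
proof -
  let ?R = "resolvent D A a"
  have bij: "bij_betw (\<lambda>x. a *\<^sub>R x - A x) D UNIV" and R_bl: "bounded_linear ?R"
    using a_resolvent by (auto simp: resolvent_set_def)
  interpret R: bounded_linear ?R by (rule R_bl)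
  have R: "?R y \<in> D" "a *\<^sub>R ?R y - A (?R y) = y" for y
    using bij unfolding resolvent_def bij_betw_def by (metis UNIV_I inv_into_into, metis UNIV_I f_inv_into_f)
  obtain M0 \<omega> where \<omega>: "0 < \<omega>" and M0: "\<And>t. 0 \<le> t \<Longrightarrow> norm (T t) \<le> M0 * exp (- \<omega> * t)"
    using stable unfolding exponentially_stable_def by blast
  \<comment> \<open>On a trivial space \<open>M0\<close> need not be positive, while the comparison
    function and the choice of the block length require a positive constant.\<close>
  define M where "M = max 1 M0"
  have M: "1 \<le> M" by (simp add: M_def)
  have T_bound: "norm (T t) \<le> M * exp (- \<omega> * t)" if "0 \<le> t" for t
    by (rule order_trans[OF M0[OF that]]) (simp add: M_def)
  have T1_bound: "norm (T1 t) \<le> M" if t: "0 \<le> t" for t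
  proof (rule norm_blinfun_bound)
    show "0 \<le> M" using M by simp
    fix b
    have "closed {b. norm (T1 t b) \<le> M * norm b}"
      by (intro closed_Collect_le continuous_intros)
    moreover have "range j \<subseteq> {b. norm (T1 t b) \<le> M * norm b}"
    proof safe
      fix x
      have "norm (T1 t (j x)) = norm (T t (?R x))"
        by (simp add: T1_extends[OF t] j_norm resolvent_commutes[OF gen a_resolvent t])
      also have "\<dots> \<le> M * exp (- \<omega> * t) * norm (?R x)"
        by (rule order_trans[OF norm_blinfun]) (intro mult_right_mono T_bound t norm_ge_zero)
      also have "\<dots> \<le> M * norm (j x)"
        using M \<omega> t unfolding j_norm by (intro mult_right_mono) (auto simp: mult_le_cancel_left1)
      finally show "norm (T1 t (j x)) \<le> M * norm (j x)" .
    qed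
    ultimately show "norm (T1 t b) \<le> M * norm b"
      using closure_minimal[of "range j"] j_dense by blast
  qed
  define V where "V n y = a *\<^sub>R ?R y - (T (1 / real (Suc n)) (?R y) - ?R y) /\<^sub>R (1 / real (Suc n))" for n y
  \<comment> \<open>\<open>V n\<close> is the bounded operator \<open>L n\<close> after the
    resolvent, and the norm of the resolvent of \<open>x\<close> is that of \<open>j x\<close>; this
    is the bound of \<open>V n\<close> by the extrapolation norm.\<close>
  define L where "L n = a *\<^sub>R id_blinfun - (T (1 / real (Suc n)) - id_blinfun) /\<^sub>R (1 / real (Suc n))" for n
  have V_eq: "V n y = L n (?R y)" for n y
    by (simp add: V_def L_def blinfun.diff_left blinfun.scaleR_left)
  have V_lim: "(\<lambda>n. V n y) \<longlonglongrightarrow> y" for y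
  proof -
    have "((\<lambda>h. (T h (?R y) - ?R y) /\<^sub>R h) \<longlongrightarrow> A (?R y)) (at_right 0)"
      using gen R(1) unfolding generates_def by blast
    moreover have "filterlim (\<lambda>n. 1 / real (Suc n)) (at_right 0) sequentially"
      unfolding filterlim_at using LIMSEQ_inverse_real_of_nat by (auto simp: inverse_eq_divide)
    ultimately have "(\<lambda>n. (T (1 / real (Suc n)) (?R y) - ?R y) /\<^sub>R (1 / real (Suc n))) \<longlonglongrightarrow> A (?R y)"
      by (rule filterlim_compose)
    then have "(\<lambda>n. V n y) \<longlonglongrightarrow> a *\<^sub>R ?R y - A (?R y)"
      unfolding V_def by (intro tendsto_diff tendsto_const)
    then show ?thesis by (simp only: R(2))
  qed
  have "stable_input_system T j T1 B q M \<omega> V"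
  proof (rule stable_input_system.intro)
    show "C0_semigroup T" using gen by (simp add: generates_def)
    show "T1 (s + t) = T1 s o\<^sub>L T1 t" if "0 \<le> s" "0 \<le> t" for s t
      using T1_generator that by (auto simp: generates_def C0_semigroup_def)
    show "inj j"
    proof (rule injI)
      \<comment> \<open>Injectivity comes from the resolvent: \<open>j_norm\<close> makes
        \<open>x\<close> and \<open>y\<close> have the same resolvent image, and applying
        \<open>a I - A\<close> recovers them.\<close>
      fix x y assume "j x = j y"
      then have "?R (x - y) = 0"
        using j_norm[of "x - y"] by (simp add: linear_diff[OF j_linear])
      then have "?R x = ?R y" by (simp add: R.diff)
      then show "x = y" by (metis R(2))
    qed
    show "linear (V n)" for n
      by (rule linearI) (simp_all add: V_eq R.add R.scaleR blinfun.add_right blinfun.scaleR_right)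
    show "\<exists>c. \<forall>x. norm (V n x) \<le> c * norm (j x)" for n
      unfolding V_eq j_norm using norm_blinfun by blast
  qed (use T_bound M \<omega> j_linear T1_extends T1_bound V_lim q admissible in auto)
  then show ?thesis by blast
qed

theorem corollary4p8:
  fixes hatA :: "'x::banach \<Rightarrow> 'x" and hatG :: "'x \<Rightarrow> 'u::banach"
    and DA DG :: "'x set"
    and T :: "real \<Rightarrow> 'x \<Rightarrow>\<^sub>L 'x" and G :: "'u \<Rightarrow>\<^sub>L 'x"
    and a :: real and j :: "'x \<Rightarrow> 'e::banach"
    and T1 :: "real \<Rightarrow> 'e \<Rightarrow>\<^sub>L 'e" and A1 :: "'e \<Rightarrow> 'e"
    and B :: "'u \<Rightarrow>\<^sub>L 'e"
    and p q :: ennreal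
  assumes "boundary_control_system DA hatA DG hatG T G"
    and "extrapolation_space (DA \<inter> {x \<in> DG. hatG x = 0}) hatA T a j T1 A1"
    and "\<And>u. B u = j (hatA (G u)) - A1 (j (G u))"
    and "1 \<le> q" and "q < \<infinity>"
    and "admissible j T1 B q"
    and "exponentially_stable T"
    and "q \<le> p"
  shows "ISS_control_system (Lp_space p) (Lp_norm p)
           (mild_domain j T1 B (Lp_space p)) (mild_solution T j T1 B)"
proof -
  have "generates (DA \<inter> {x \<in> DG. hatG x = 0}) hatA T"
    using assms(1) by (rule boundary_control_system.generator)
  then obtain M \<omega> V where "stable_input_system T j T1 B q M \<omega> V"
    using extrapolation_space.stable_input_systemI[OF assms(2) _ assms(7,4,5,6)] by blast
  then show ?thesis
    using assms(8) by (rule stable_input_system.mild_ISS)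
qed

end
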